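(* Let $m$ be a positive integer and let $\{(A_i,B_i)\}_{i=1}^m$ be a collection of pairs of finite sets such that $|A_i|=a<|B_i|=b$ for every $1\le i\le m$. Suppose that \begin{itemize} \item $|A_i\cap A_j|>0$ for all $1\le i,j\le m$ (including $i=j$), \item for all $1\le i,j\le m$, $|A_i\cap B_j|=0$ if and only if $i=j$. \end{itemize} Then $m=\binom{a+b-1}{a-1}$ if and only if the ground set $X=\bigcup_{i=1}^m(A_i\cup B_i)$ has cardinality $a+b$, $\{A_i\}_{i=1}^m$ is the family of all subsets of $X$ of size $a$ containing a fixed element of $X$, and $B_i=X\setminus A_i$ for each $1\le i\le m$. *)

theory Defs
  imports Main
begin

end

theory Submission
  imports Defs Complex_Main "HOL-Library.Nat_Bijection" "HOL-Library.Z2"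
    "HOL-Computational_Algebra.Polynomial" "HOL-Computational_Algebra.Fraction_Field"
begin

text \<open>
  Put the points of \<open>X\<close> on the moment curve in \<open>K\<^sup>n\<close>, \<open>n = a + b\<close>, where \<open>K\<close> is an infinite field of
  characteristic two, and let \<open>p(S)\<close> be the exterior product of the vectors of \<open>S\<close>. Since
  \<open>p(A\<^sub>i) p(B\<^sub>j) \<noteq> 0\<close> exactly for \<open>i = j\<close>, the \<open>p(A\<^sub>i)\<close> span a space \<open>U\<close> of dimension \<open>m\<close>, and \<open>U U = 0\<close> because the
  \<open>A\<^sub>i\<close> intersect. The leading monomials of \<open>U\<close> form an intersecting family of \<open>a\<close>-subsets of an \<open>n\<close>-set
  (Scott and Wilmer). If \<open>m\<close> is the Erdos--Ko--Rado number, this family is a star, and \<open>U U = 0\<close> then forces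
  \<open>v U = 0\<close> for some vector \<open>v \<noteq> 0\<close>. So \<open>v\<close> lies in the span of every \<open>A\<^sub>i\<close>, and general position gives a
  point \<open>x\<close> common to all \<open>A\<^sub>i\<close>. The pairs \<open>(A\<^sub>i - {x}, B\<^sub>i)\<close> attain Bollobas' bound, and in the equality case
  of that bound all unions of the two sets of a pair coincide.
\<close>

section \<open>Intersecting families\<close>

text \<open>Characteristic two turns the exterior algebra into a commutative ring, so no signs have
  to be tracked. An infinite field leaves room for any number of points on the moment curve, any
  \<open>n\<close> of which are independent. With \<open>n = a + b\<close>, the product over
  \<open>A i\<close> and \<open>B i\<close> lands in top degree, and \<open>a < b\<close> becomes
  \<open>2 * a < n\<close>, the range in which stars are the only extremal intersecting families.
  The obstacle is that a star of leading sets describes leading terms only; it does not yet give the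
  elements of \<open>U\<close> a common factor. The equations \<open>u * v = 0\<close> for reduced
  basis vectors, read one coefficient at a time, supply the rest, and connectedness of a Kneser
  graph makes these local equations global. The final count fits because
  \<open>(a + b - 1) choose (a - 1)\<close> is at once the Erdos-Ko-Rado number for
  \<open>a\<close>-subsets of an \<open>(a + b)\<close>-set and Bollobas' bound for sets of sizes
  \<open>a - 1\<close> and \<open>b\<close>.\<close>

lemma card_swap:
  assumes "finite T" "x \<in> T" "y \<notin> T"
  shows "card (insert y (T - {x})) = card T"
  using assms by (metis Diff_iff card.insert_remove card_Suc_Diff1 card_insert_disjoint finite_Diff)

text \<open>Each exchange takes a point of \<open>T - T'\<close> for one of \<open>T' - T\<close>,
  so the distance \<open>card (T' - T)\<close> drops; equal cardinalities guarantee that both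
  differences are nonempty together.\<close>

lemma swap_induct:
  assumes "finite T'" and "card T = r" and "card T' = r" and "T \<subseteq> Y" and "T' \<subseteq> Y" and "finite Y"
    and "P T"
    and swap: "\<And>T x y. T \<subseteq> Y \<Longrightarrow> card T = r \<Longrightarrow> P T \<Longrightarrow> x \<in> T \<Longrightarrow> y \<in> Y - T \<Longrightarrow> P (insert y (T - {x}))"
  shows "P T'"
  using assms(2,4,7)
proof (induction "card (T' - T)" arbitrary: T)
  case 0
  then have "T' \<subseteq> T"
    using assms(1) by simp
  then have "T' = T"
    using 0 assms(3,6) by (metis card_subset_eq finite_subset)
  then show ?case
    using 0 by simp
next
  case (Suc d)
  have fin: "finite T"
    using Suc.prems(2) assms(6) finite_subset by blast
  obtain y where y: "y \<in> T'" "y \<notin> T"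
    using Suc.hyps(2) by (metis DiffE card.empty equals0I nat.distinct(1))
  have "card (T - T') = card (T' - T)"
    using card_le_sym_Diff[of T T'] card_le_sym_Diff[of T' T] fin assms(1,3) Suc.prems(1) by simp
  then obtain x where x: "x \<in> T" "x \<notin> T'"
    using Suc.hyps(2) by (metis DiffE card.empty equals0I nat.distinct(1))
  let ?U = "insert y (T - {x})"
  have "T' - ?U = (T' - T) - {y}"
    using x by auto
  then have "d = card (T' - ?U)"
    using Suc.hyps(2) y assms(1) by simp
  moreover have "card ?U = r"
    using x y fin Suc.prems(1) card_swap by metis
  moreover have "?U \<subseteq> Y"
    using y assms(5) Suc.prems(2) by auto
  moreover have "P ?U"
    using swap[OF Suc.prems(2,1,3)] x y assms(5) by auto
  ultimately show ?case
    using Suc.hyps(1) by blast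
qed

text \<open>A single exchange is a path of two Kneser edges: \<open>T\<close> and
  \<open>insert y (T - {x})\<close> both lie in the \<open>(r + 1)\<close>-set
  \<open>insert y T\<close>, and its complement still has room for an \<open>r\<close>-set disjoint
  from both.\<close>

lemma kneser_connected:
  assumes "finite Y" and "2 * r + 1 \<le> card Y"
    and "T \<subseteq> Y" "card T = r" "P T" and "T' \<subseteq> Y" "card T' = r"
    and disj: "\<And>T T'. T \<subseteq> Y \<Longrightarrow> T' \<subseteq> Y \<Longrightarrow> card T = r \<Longrightarrow> card T' = r \<Longrightarrow> T \<inter> T' = {} \<Longrightarrow> P T \<Longrightarrow> P T'"
  shows "P T'"
proof (rule swap_induct[of T' T r Y])
  show "finite T'"
    using assms(1,6) finite_subset by blast
next
  fix T x y
  assume T: "T \<subseteq> Y" "card T = r" "P T" "x \<in> T" "y \<in> Y - T"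
  have fin: "finite T"
    using T(1) assms(1) finite_subset by blast
  let ?U = "insert y T"
  have "card (Y - ?U) = card Y - (r + 1)"
    using T fin assms(1) by (subst card_Diff_subset) auto
  then have "r \<le> card (Y - ?U)"
    using assms(2) by simp
  then obtain R where R: "R \<subseteq> Y - ?U" "card R = r"
    by (meson obtain_subset_with_card_n)
  have "P R"
    using disj[of T R] T R by auto
  moreover have "card (insert y (T - {x})) = r"
    using T fin card_swap by (metis DiffD2)
  ultimately show "P (insert y (T - {x}))"
    using disj[of R "insert y (T - {x})"] T R by auto
qed (use assms in auto)

section \<open>Intersecting families and stars\<close>

definition intersecting :: "'a set set \<Rightarrow> bool"
  where "intersecting F \<longleftrightarrow> (\<forall>S\<in>F. \<forall>T\<in>F. S \<inter> T \<noteq> {})"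

lemma intersectingD: "intersecting F \<Longrightarrow> S \<in> F \<Longrightarrow> T \<in> F \<Longrightarrow> S \<inter> T \<noteq> {}"
  by (simp add: intersecting_def)

definition ksub :: "'a set \<Rightarrow> nat \<Rightarrow> 'a set set"
  where "ksub X k = {S. S \<subseteq> X \<and> card S = k}"

lemma finite_ksub: "finite X \<Longrightarrow> finite (ksub X k)"
  unfolding ksub_def by auto

lemma card_ksub: "finite X \<Longrightarrow> card (ksub X k) = card X choose k"
  unfolding ksub_def by (rule n_subsets)

lemma ksub_finite: "S \<in> ksub X k \<Longrightarrow> finite X \<Longrightarrow> finite S"
  unfolding ksub_def using finite_subset by auto


lemma star_eq:
  assumes "e \<in> X" "k \<ge> 1" "finite X"
  shows "{S \<in> ksub X k. e \<in> S} = insert e ` ksub (X - {e}) (k - 1)"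
proof (intro equalityI subsetI)
  fix S assume "S \<in> {S \<in> ksub X k. e \<in> S}"
  then have "S - {e} \<in> ksub (X - {e}) (k - 1)" "S = insert e (S - {e})"
    by (auto simp: ksub_def)
  then show "S \<in> insert e ` ksub (X - {e}) (k - 1)"
    by blast
next
  fix S assume "S \<in> insert e ` ksub (X - {e}) (k - 1)"
  then obtain T where T: "S = insert e T" "T \<subseteq> X - {e}" "card T = k - 1"
    by (auto simp: ksub_def)
  moreover have "finite T"
    using T assms by (meson finite_Diff finite_subset)
  ultimately have "card (insert e T) = k"
    using assms(2) by (subst card_insert_disjoint) auto
  then show "S \<in> {S \<in> ksub X k. e \<in> S}"
    using T assms by (auto simp: ksub_def)
qed

lemma card_star:
  assumes "e \<in> X" "k \<ge> 1" "finite X"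
  shows "card {S \<in> ksub X k. e \<in> S} = (card X - 1) choose (k - 1)"
proof -
  have "inj_on (insert e) (ksub (X - {e}) (k - 1))"
    by (rule inj_onI) (auto simp: ksub_def insert_ident)
  then show ?thesis
    using assms by (simp add: star_eq card_image card_ksub)
qed

lemma star_unique:
  assumes "finite X" "e \<in> X" "k \<ge> 1" "F \<subseteq> ksub X k" "\<And>S. S \<in> F \<Longrightarrow> e \<in> S"
    and "card F = (card X - 1) choose (k - 1)"
  shows "F = {S \<in> ksub X k. e \<in> S}"
  using assms by (intro card_subset_eq) (auto simp: finite_ksub card_star)

section \<open>Compression and the Erdos-Ko-Rado theorem\<close>

definition shift :: "'a \<Rightarrow> 'a \<Rightarrow> 'a set \<Rightarrow> 'a set"
  where "shift p i S = (if p \<in> S \<and> i \<notin> S then insert i (S - {p}) else S)"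

text \<open>A set whose shift is already taken stays where it is; this keeps the number of
  members.\<close>

definition shift_family :: "'a \<Rightarrow> 'a \<Rightarrow> 'a set set \<Rightarrow> 'a set set"
  where "shift_family p i F = {S \<in> F. shift p i S \<in> F} \<union> shift p i ` {S \<in> F. shift p i S \<notin> F}"

lemma card_shift: "finite S \<Longrightarrow> card (shift p i S) = card S"
  by (auto simp: shift_def intro: card_swap simp del: card_insert_disjoint card_Diff_insert card_Diff_singleton_if card.insert)

lemma shift_ksub:
  assumes "i \<in> X" "finite X" "S \<in> ksub X k"
  shows "shift p i S \<in> ksub X k"
proof -
  have "card (shift p i S) = k"
    using card_shift[of S p i] ksub_finite[OF assms(3,2)] assms(3) by (simp add: ksub_def)
  moreover have "shift p i S \<subseteq> X"
    using assms by (auto simp: ksub_def shift_def)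
  ultimately show ?thesis
    by (simp add: ksub_def)
qed

lemma shift_family_ksub:
  "i \<in> X \<Longrightarrow> finite X \<Longrightarrow> F \<subseteq> ksub X k \<Longrightarrow> shift_family p i F \<subseteq> ksub X k"
  using shift_ksub[of i X _ k p] unfolding shift_family_def by (auto simp: subset_iff)

lemma card_shift_family:
  assumes "finite F"
  shows "card (shift_family p i F) = card F"
proof -
  have inj: "inj_on (shift p i) {S \<in> F. shift p i S \<notin> F}"
  proof (rule inj_onI)
    fix S T assume ST: "S \<in> {S \<in> F. shift p i S \<notin> F}" "T \<in> {S \<in> F. shift p i S \<notin> F}"
      and eq: "shift p i S = shift p i T"
    have "p \<in> S" "i \<notin> S" "p \<in> T" "i \<notin> T"
      using ST by (auto simp: shift_def split: if_splits)
    then show "S = T"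
      using eq by (auto simp: shift_def set_eq_iff)
  qed
  have "card (shift_family p i F) = card {S \<in> F. shift p i S \<in> F} + card (shift p i ` {S \<in> F. shift p i S \<notin> F})"
    unfolding shift_family_def using assms by (intro card_Un_disjoint) auto
  also have "\<dots> = card {S \<in> F. shift p i S \<in> F} + card {S \<in> F. shift p i S \<notin> F}"
    by (simp add: card_image[OF inj])
  also have "\<dots> = card ({S \<in> F. shift p i S \<in> F} \<union> {S \<in> F. shift p i S \<notin> F})"
    using assms by (intro card_Un_disjoint[symmetric]) auto
  also have "{S \<in> F. shift p i S \<in> F} \<union> {S \<in> F. shift p i S \<notin> F} = F"
    by auto
  finally show ?thesis .
qed

text \<open>Membership expressed through \<open>F\<close> alone: a member is either old with its
  shift also in \<open>F\<close>, or it has been moved and undoing the move leads back to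
  \<open>F\<close>.\<close>

lemma shift_family_memD:
  assumes "S \<in> shift_family p i F"
  shows "(S \<in> F \<and> shift p i S \<in> F) \<or> (i \<in> S \<and> p \<notin> S \<and> insert p (S - {i}) \<in> F)"
proof -
  consider "S \<in> F" "shift p i S \<in> F" | T where "T \<in> F" "shift p i T \<notin> F" "S = shift p i T"
    using assms by (auto simp: shift_family_def)
  then show ?thesis
  proof cases
    case 2
    then have "p \<in> T" "i \<notin> T"
      by (auto simp: shift_def split: if_splits)
    moreover from this have "p \<noteq> i"
      by auto
    ultimately have "i \<in> S" "p \<notin> S" "insert p (S - {i}) = T"
      using 2 by (auto simp: shift_def)
    then show ?thesis
      using 2 by simp
  qed auto
qed

lemma intersecting_shift_family:
  assumes "intersecting F"
  shows "intersecting (shift_family p i F)"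
  unfolding intersecting_def
proof (intro ballI)
  have F: "S \<inter> T \<noteq> {}" if "S \<in> F" "T \<in> F" for S T
    using assms that by (auto simp: intersecting_def)
  \<comment> \<open>If \<open>S\<close> meets the preimage of the moved set \<open>T\<close> only in
    \<open>p\<close>, then either \<open>i\<close> is common to \<open>S\<close> and
    \<open>T\<close>, or the shift of \<open>S\<close>, which is also in \<open>F\<close>, meets
    that preimage in a point other than \<open>p\<close>.\<close>
  have mixed: "S \<inter> T \<noteq> {}" if S: "S \<in> F" "shift p i S \<in> F"
    and T: "i \<in> T" "p \<notin> T" "insert p (T - {i}) \<in> F" for S T
    using F[OF S(1) T(3)] F[OF S(2) T(3)] T(1,2)
    by (auto simp: shift_def split: if_splits)
  fix S T assume "S \<in> shift_family p i F" "T \<in> shift_family p i F"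
  then show "S \<inter> T \<noteq> {}"
    using shift_family_memD[of S p i F] shift_family_memD[of T p i F] F[of S T] mixed[of S T] mixed[of T S]
    by blast
qed

text \<open>A compression cannot create an extremal star from a family without a common point. The
  critical centre is \<open>i\<close>: every \<open>(k - 1)\<close>-set \<open>T\<close> avoiding
  \<open>p\<close> and \<open>i\<close> then has exactly one of \<open>insert i T\<close>,
  \<open>insert p T\<close> in \<open>F\<close>. Disjoint sets make the same choice, since
  \<open>insert i T'\<close> would miss \<open>insert p T\<close>. The bound
  \<open>2 * k < card X\<close> makes the Kneser graph on \<open>X - {p, i}\<close> connected, so
  the choice is global.\<close>

lemma star_unshift:
  assumes fin: "finite X" and "2 * k < card X" and k: "k \<ge> 1" and F: "F \<subseteq> ksub X k" "intersecting F"
    and pi: "p \<in> X" "i \<in> X" "p \<noteq> i"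
    and card: "card F = (card X - 1) choose (k - 1)"
    and neq: "shift_family p i F \<noteq> F"
    and c: "c \<in> X" "\<And>S. S \<in> shift_family p i F \<Longrightarrow> c \<in> S"
  shows "\<exists>e\<in>X. \<forall>S\<in>F. e \<in> S"
proof -
  have finF: "finite F"
    using F fin finite_ksub finite_subset by metis
  have full: "shift_family p i F = {S \<in> ksub X k. c \<in> S}"
    using assms card_shift_family[OF finF, of p i] shift_family_ksub[of i X F k p]
    by (intro star_unique) auto
  \<comment> \<open>A set that really moves ends up without \<open>p\<close>, which excludes
    \<open>p\<close> as the centre.\<close>
  obtain S0 where S0: "S0 \<in> F" "shift p i S0 \<notin> F"
    using neq by (auto simp: shift_family_def)
  then have "p \<notin> shift p i S0" "shift p i S0 \<in> shift_family p i F"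
    using pi by (auto simp: shift_def shift_family_def split: if_splits)
  then have cp: "c \<noteq> p"
    using c by auto
  have stay: "S \<in> shift_family p i F" if "S \<in> F" "shift p i S = S" for S
    using that by (auto simp: shift_family_def)
  show ?thesis
  proof (cases "c = i")
    case False
    have "c \<in> S" if "S \<in> F" for S
    proof (cases "shift p i S \<in> F")
      case True
      then show ?thesis
        using that c(2)[of S] by (auto simp: shift_family_def)
    next
      case F: False
      then have "c \<in> shift p i S"
        using that c(2)[of "shift p i S"] by (auto simp: shift_family_def)
      then show ?thesis
        using False cp by (auto simp: shift_def split: if_splits)
    qed
    then show ?thesis
      using c by blast
  next
    case True
    have either: "i \<in> S \<or> p \<in> S" if "S \<in> F" for S
    proof (rule ccontr)
      assume "\<not> (i \<in> S \<or> p \<in> S)"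
      then have "shift p i S = S" and "i \<notin> S"
        by (simp_all add: shift_def)
      then show False
        using stay[of S] c(2)[of S] that True by blast
    qed
    let ?Y = "X - {p, i}"
    let ?r = "k - 1"
    let ?P = "\<lambda>T. insert p T \<in> F"
    have cardY: "2 * ?r + 1 \<le> card ?Y"
      using assms(2) pi k fin by (subst card_Diff_subset) auto
    have one: "insert i T \<in> F \<or> insert p T \<in> F" if "T \<subseteq> ?Y" "card T = ?r" for T
    proof -
      have "finite T"
        using that fin by (meson finite_Diff finite_subset)
      then have "card (insert i T) = k"
        using that k by (subst card_insert_disjoint) auto
      then have "insert i T \<in> shift_family p i F"
        using that True pi unfolding full ksub_def by auto
      moreover have "insert p (insert i T - {i}) = insert p T"
        using that by auto
      ultimately show ?thesis
        using shift_family_memD[of "insert i T" p i F] by auto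
    qed
    have not_both: "\<not> (insert i T \<in> F \<and> insert p T \<in> F)" if "T \<subseteq> ?Y" for T
    proof
      assume both: "insert i T \<in> F \<and> insert p T \<in> F"
      moreover have "shift p i (insert p T) = insert i T"
        using that pi by (auto simp: shift_def)
      ultimately have "insert p T \<in> shift_family p i F"
        by (auto simp: shift_family_def)
      then show False
        using c(2)[of "insert p T"] True that pi by auto
    qed
    have step: "insert p T' \<in> F" if "T \<subseteq> ?Y" "T' \<subseteq> ?Y" "card T = ?r" "card T' = ?r" "T \<inter> T' = {}" "insert p T \<in> F" for T T'
    proof (rule ccontr)
      assume "insert p T' \<notin> F"
      then have "insert i T' \<in> F"
        using one that by blast
      then have "insert i T' \<inter> insert p T \<noteq> {}"
        using intersectingD[OF F(2), of "insert i T'" "insert p T"] that by simp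
      then show False
        using that pi by auto
    qed
    show ?thesis
    proof (cases "\<exists>T. T \<subseteq> ?Y \<and> card T = ?r \<and> insert p T \<in> F")
      case True
      then obtain T0 where T0: "T0 \<subseteq> ?Y" "card T0 = ?r" "insert p T0 \<in> F"
        by blast
      have all: "insert p T \<in> F" if "T \<subseteq> ?Y" "card T = ?r" for T
        using kneser_connected[of ?Y ?r T0 ?P T] fin cardY T0 that step by blast
      have "p \<in> S" if S: "S \<in> F" for S
      proof (rule ccontr)
        assume "p \<notin> S"
        then have "i \<in> S"
          using either S by blast
        then have "S - {i} \<subseteq> ?Y" "card (S - {i}) = ?r" "insert i (S - {i}) = S"
          using S F \<open>p \<notin> S\<close> by (auto simp: ksub_def)
        then show False
          using all not_both S by metis
      qed
      then show ?thesis
        using pi by blast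
    next
      case False
      have "i \<in> S" if S: "S \<in> F" for S
      proof (rule ccontr)
        assume "i \<notin> S"
        then have "p \<in> S"
          using either S by blast
        then have "S - {p} \<subseteq> ?Y" "card (S - {p}) = ?r" "insert p (S - {p}) = S"
          using S F \<open>i \<notin> S\<close> by (auto simp: ksub_def)
        then show False
          using False S by metis
      qed
      then show ?thesis
        using pi by blast
    qed
  qed
qed

text \<open>The termination measure for repeated compression away from \<open>p\<close>.\<close>

lemma card_shift_family_less:
  assumes "finite F" "p \<noteq> i" "shift_family p i F \<noteq> F"
  shows "card {S \<in> shift_family p i F. p \<in> S} < card {S \<in> F. p \<in> S}"
proof (rule psubset_card_mono)
  obtain S0 where S0: "S0 \<in> F" "shift p i S0 \<notin> F"
    using assms(3) by (auto simp: shift_family_def)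
  have sub: "{S \<in> shift_family p i F. p \<in> S} \<subseteq> {S \<in> F. p \<in> S}"
    using shift_family_memD by fastforce
  have "p \<in> S0"
    using S0 by (auto simp: shift_def split: if_splits)
  moreover have "S0 \<notin> shift_family p i F"
    using S0 shift_family_memD[of S0 p i F] \<open>p \<in> S0\<close> by blast
  ultimately show "{S \<in> shift_family p i F. p \<in> S} \<subset> {S \<in> F. p \<in> S}"
    using sub S0(1) by blast
qed (use assms in auto)


text \<open>An intersecting family contains at most one set of each complementary pair, hence at
  most half of all \<open>k\<close>-sets. This boundary case is separate because removing a point
  from \<open>X\<close> would leave fewer than \<open>2 * k\<close> points.\<close>

lemma ekr_complement_bound:
  assumes "finite X" "card X = 2 * k" "k \<ge> 1" "F \<subseteq> ksub X k" "intersecting F"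
  shows "card F \<le> (card X - 1) choose (k - 1)"
proof -
  have finF: "finite F"
    using assms finite_ksub finite_subset by metis
  let ?G = "(\<lambda>S. X - S) ` F"
  have "inj_on (\<lambda>S. X - S) F"
    using assms(4) by (intro inj_onI) (simp add: ksub_def subset_iff double_diff set_eq_iff, blast)
  then have "card ?G = card F"
    by (rule card_image)
  moreover have "F \<inter> ?G = {}"
    using assms(5) by (force simp: intersecting_def)
  moreover have "F \<union> ?G \<subseteq> ksub X k"
  proof -
    have "X - S \<in> ksub X k" if "S \<in> F" for S
    proof -
      have "S \<subseteq> X" "card S = k"
        using that assms(4) by (auto simp: ksub_def)
      then show ?thesis
        using assms(1,2) by (auto simp: ksub_def card_Diff_subset finite_subset)
    qed
    then show ?thesis
      using assms(4) by auto
  qed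
  ultimately have "card F + card F \<le> (2 * k) choose k"
    using card_mono[of "ksub X k" "F \<union> ?G"] finF assms(1,2)
    by (simp add: card_Un_disjoint finite_ksub card_ksub)
  moreover have "(2 * k) choose k = 2 * ((2 * k - 1) choose (k - 1))"
  proof -
    obtain j where k: "k = Suc j"
      using assms(3) by (cases k) auto
    have "Suc (2 * j + 1) choose Suc j = (2 * j + 1 choose j) + (2 * j + 1 choose Suc j)"
      by (rule binomial_Suc_Suc)
    moreover have "(2 * j + 1 choose Suc j) = (2 * j + 1 choose j)"
      using binomial_symmetric[of j "2 * j + 1"] by simp
    ultimately show ?thesis
      using k by simp
  qed
  ultimately show ?thesis
    using assms(2) by simp
qed

text \<open>Shifting only towards the removal of one point \<open>p\<close> is enough: once the family is stable under
  these shifts, the link of \<open>p\<close> is intersecting, and induction applies to the link and the deletion of \<open>p\<close>.\<close>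

theorem erdos_ko_rado:
  assumes "finite X" "2 * k \<le> card X" "k \<ge> 1" "F \<subseteq> ksub X k" "intersecting F"
  shows "card F \<le> (card X - 1) choose (k - 1) \<and>
    (2 * k < card X \<and> card F = (card X - 1) choose (k - 1) \<longrightarrow> (\<exists>e\<in>X. \<forall>S\<in>F. e \<in> S))"
  using assms
proof (induction "card X" arbitrary: X k F)
  case 0
  then show ?case
    by simp
next
  case (Suc n)
  note IH = Suc.hyps(1)
  consider "2 * k = card X" | "k = 1" "2 * k < card X" | "k > 1" "2 * k < card X"
    using Suc.prems by linarith
  then show ?case
  proof cases
    case 1
    then show ?thesis
      using ekr_complement_bound[of X k F] Suc.prems by simp
  next
    case 2
    have sub: "F \<subseteq> {S}" if "S \<in> F" for S
    proof
      fix T assume "T \<in> F"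
      then have "S \<inter> T \<noteq> {}"
        using that Suc.prems by (auto simp: intersecting_def)
      moreover have "card S = 1" "card T = 1"
        using that \<open>T \<in> F\<close> 2 Suc.prems by (auto simp: ksub_def)
      ultimately show "T \<in> {S}"
        by (auto simp: card_1_singleton_iff)
    qed
    show ?thesis
    proof (cases "F = {}")
      case False
      then obtain S where S: "S \<in> F"
        by blast
      then have F: "F = {S}"
        using sub by blast
      have "S \<subseteq> X" "card S = 1"
        using S 2 Suc.prems by (auto simp: ksub_def)
      then show ?thesis
        using F 2 by (auto simp: card_1_singleton_iff)
    qed (use 2 in simp)
  next
    case 3
    obtain p where p: "p \<in> X"
      using Suc.hyps(2) by (metis card.empty ex_in_conv nat.distinct(1))
    let ?Y = "X - {p}"
    have Y: "finite ?Y" "card ?Y = n"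
      using p Suc.prems Suc.hyps(2) by auto
    \<comment> \<open>The inner induction repeats nontrivial shifts until none is left; the outer
      hypothesis, for fewer points, is applied only to stable families.\<close>
    show ?thesis
      using Suc.prems(4,5)
    proof (induction "card {S \<in> F. p \<in> S}" arbitrary: F rule: less_induct)
      case (less F)
      have finF: "finite F"
        using less.prems Suc.prems finite_ksub finite_subset by metis
      show ?case
      proof (cases "\<exists>i\<in>X - {p}. shift_family p i F \<noteq> F")
        case True
        then obtain i where i: "i \<in> X" "i \<noteq> p" "shift_family p i F \<noteq> F"
          by blast
        have sub: "shift_family p i F \<subseteq> ksub X k" and int: "intersecting (shift_family p i F)"
          and lt: "card {S \<in> shift_family p i F. p \<in> S} < card {S \<in> F. p \<in> S}"
          using i shift_family_ksub Suc.prems(1) less.prems intersecting_shift_family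
            card_shift_family_less[OF finF _ i(3)] by metis+
        note hyp = less.hyps[OF lt sub int]
        have eq: "card (shift_family p i F) = card F"
          using card_shift_family[OF finF] .
        show ?thesis
        proof (intro conjI impI)
          show "card F \<le> (card X - 1) choose (k - 1)"
            using hyp eq by simp
          assume card: "2 * k < card X \<and> card F = (card X - 1) choose (k - 1)"
          then obtain c where "c \<in> X" "\<And>S. S \<in> shift_family p i F \<Longrightarrow> c \<in> S"
            using hyp eq by auto
          then show "\<exists>e\<in>X. \<forall>S\<in>F. e \<in> S"
            using star_unshift[of X k F p i c] card i p Suc.prems less.prems by auto
        qed
      next
        case False
        then have stable: "shift p i S \<in> F" if "i \<in> X" "i \<noteq> p" "S \<in> F" for i S
          using that by (auto simp: shift_family_def)
        define F0 where "F0 = {S \<in> F. p \<notin> S}"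
        define F1 where "F1 = (\<lambda>S. S - {p}) ` {S \<in> F. p \<in> S}"
        have inj: "inj_on (\<lambda>S. S - {p}) {S \<in> F. p \<in> S}"
          by (rule inj_onI) auto
        have split: "card F = card F0 + card F1"
        proof -
          have "card F = card ({S \<in> F. p \<notin> S} \<union> {S \<in> F. p \<in> S})"
            by (rule arg_cong[of _ _ card]) auto
          also have "\<dots> = card F0 + card {S \<in> F. p \<in> S}"
            unfolding F0_def using finF by (intro card_Un_disjoint) auto
          finally show ?thesis
            unfolding F1_def card_image[OF inj] .
        qed
        have F0: "F0 \<subseteq> ksub ?Y k" "intersecting F0"
          using less.prems by (auto simp: F0_def ksub_def intersecting_def)
        have F1: "F1 \<subseteq> ksub ?Y (k - 1)"
          using less.prems by (auto simp: F1_def ksub_def)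
        \<comment> \<open>If \<open>S\<close> and \<open>T\<close> were disjoint,
          \<open>insert p S\<close> and \<open>insert p T\<close> would meet in \<open>p\<close>
          only. Their union has at most \<open>2 * k - 1\<close> points, so some \<open>i\<close>
          lies outside it, and stability replaces \<open>p\<close> by \<open>i\<close> in the first
          set, which then misses the second.\<close>
        have int1: "intersecting F1"
          unfolding intersecting_def
        proof (intro ballI notI)
          fix S T assume "S \<in> F1" "T \<in> F1" and disj: "S \<inter> T = {}"
          then have ST: "insert p S \<in> F" "insert p T \<in> F" "p \<notin> S" "p \<notin> T"
            by (auto simp: F1_def insert_absorb)
          have c: "card S = k - 1" "card T = k - 1" "S \<subseteq> X" "T \<subseteq> X"
            using \<open>S \<in> F1\<close> \<open>T \<in> F1\<close> F1 by (auto simp: ksub_def)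
          have "card (insert p (S \<union> T)) \<le> Suc (card S + card T)"
            using card_Un_le[of S T] card_insert_le_m1[of "Suc (card S + card T)" "S \<union> T" p] by simp
          then have "card (insert p (S \<union> T)) < card X"
            using c 3 by simp
          then obtain i where i: "i \<in> X" "i \<notin> insert p (S \<union> T)"
            using c p by (metis card_mono finite_Un finite_insert finite_subset leD subsetI Suc.prems(1))
          have "shift p i (insert p S) = insert i S"
            using ST i by (auto simp: shift_def)
          then have "insert i S \<in> F"
            using stable[of i "insert p S"] i ST by auto
          then have "insert i S \<inter> insert p T \<noteq> {}"
            using intersectingD[OF less.prems(2), of "insert i S" "insert p T"] ST by simp
          then show False
            using disj ST i by auto
        qed
        have b0: "card F0 \<le> (n - 1) choose (k - 1)"
          using IH[of ?Y k F0] Y F0 3 Suc.hyps(2) by auto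
        have hyp1: "card F1 \<le> (n - 1) choose (k - 2) \<and>
          (card F1 = (n - 1) choose (k - 2) \<longrightarrow> (\<exists>e\<in>?Y. \<forall>S\<in>F1. e \<in> S))"
          using IH[of ?Y "k - 1" F1] Y F1 int1 3 Suc.hyps(2) by (auto simp: numeral_2_eq_2)
        have pascal: "(card X - 1) choose (k - 1) = ((n - 1) choose (k - 1)) + ((n - 1) choose (k - 2))"
        proof -
          obtain l n' where "k = Suc (Suc l)" "n = Suc n'"
            using 3 Suc.hyps(2) that[of "k - 2" "n - 1"] by simp
          then show ?thesis
            using Suc.hyps(2)[symmetric] by simp
        qed
        show ?thesis
        proof (intro conjI impI)
          show "card F \<le> (card X - 1) choose (k - 1)"
            using split b0 hyp1 pascal by linarith
          assume "2 * k < card X \<and> card F = (card X - 1) choose (k - 1)"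
          then have eq1: "card F1 = (n - 1) choose (k - 2)"
            using split b0 hyp1 pascal by linarith
          then obtain e where e: "e \<in> ?Y" "\<And>S. S \<in> F1 \<Longrightarrow> e \<in> S"
            using hyp1 by blast
          have full: "F1 = {S \<in> ksub ?Y (k - 1). e \<in> S}"
            using e F1 Y 3 eq1 by (intro star_unique) (auto simp: numeral_2_eq_2)
          \<comment> \<open>The link is the full star of \<open>e\<close>. A member avoiding both
            \<open>p\<close> and \<open>e\<close> would miss some
            \<open>insert p (insert e R)\<close>, with \<open>R\<close> chosen outside it.\<close>
          have "e \<in> S" if S: "S \<in> F" for S
          proof (cases "p \<in> S")
            case True
            then show ?thesis
              using e(2)[of "S - {p}"] S by (auto simp: F1_def)
          next
            case False
            show ?thesis
            proof (rule ccontr)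
              assume "e \<notin> S"
              have "S \<subseteq> ?Y" "card S = k" "finite S"
                using S False less.prems Suc.prems(1) finite_subset[of S X] by (auto simp: ksub_def)
              then have "card (?Y - insert e S) = n - (k + 1)"
                using Y e(1) \<open>e \<notin> S\<close> by (subst card_Diff_subset) auto
              then have "k - 2 \<le> card (?Y - insert e S)"
                using 3 Suc.hyps(2) by simp
              then obtain R where R: "R \<subseteq> ?Y - insert e S" "card R = k - 2" "finite R"
                by (meson obtain_subset_with_card_n)
              have "card (insert e R) = k - 1"
                using R 3 by (subst card_insert_disjoint) auto
              then have "insert e R \<in> F1"
                using R e(1) unfolding full by (auto simp: ksub_def)
              then obtain S' where "S' \<in> F" "p \<in> S'" "insert e R = S' - {p}"
                unfolding F1_def by blast
              then have "insert p (insert e R) \<in> F"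
                by (metis insert_Diff)
              then have "insert p (insert e R) \<inter> S \<noteq> {}"
                using intersectingD[OF less.prems(2), of "insert p (insert e R)" S] S by simp
              then show False
                using R False \<open>e \<notin> S\<close> by auto
            qed
          qed
          then show "\<exists>e\<in>X. \<forall>S\<in>F. e \<in> S"
            using e(1) by blast
        qed
      qed
    qed
  qed
qed

section \<open>Set pairs\<close>

definition cross_pairs :: "'i set \<Rightarrow> ('i \<Rightarrow> 'a set) \<Rightarrow> ('i \<Rightarrow> 'a set) \<Rightarrow> bool"
  where "cross_pairs I A B \<longleftrightarrow> (\<forall>i\<in>I. \<forall>j\<in>I. A i \<inter> B j = {} \<longleftrightarrow> i = j)"

text \<open>The left-hand side of Bollobas' inequality for pairs of varying sizes. Varying sizes are
  essential to the induction, because deleting a point shrinks some of the \<open>B i\<close> and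
  not others.\<close>

definition pair_weight :: "'i set \<Rightarrow> ('i \<Rightarrow> 'a set) \<Rightarrow> ('i \<Rightarrow> 'a set) \<Rightarrow> real"
  where "pair_weight I A B = (\<Sum>i\<in>I. 1 / real (card (A i) + card (B i) choose card (A i)))"

lemma cross_pairs_delete:
  "cross_pairs I A B \<Longrightarrow> cross_pairs {i \<in> I. x \<notin> A i} A (\<lambda>i. B i - {x})"
  by (auto simp: cross_pairs_def)

lemma cross_pairs_empty:
  assumes "cross_pairs I A B" "i \<in> I" "B i = {}"
  shows "I = {i}"
  using assms by (auto simp: cross_pairs_def)

lemma cross_pairs_swap: "cross_pairs I A B \<Longrightarrow> cross_pairs I B A"
  unfolding cross_pairs_def by (metis inf_commute)

text \<open>With \<open>s = card S\<close>, \<open>t = card T\<close> and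
  \<open>c = s + t choose s\<close>, the \<open>card X - s - t\<close> points outside both sets
  contribute \<open>1 / c\<close> each. Each of the \<open>t\<close> points of \<open>T\<close>
  contributes \<open>(s + t) / (t * c)\<close>, by the absorption identity for binomials.\<close>

lemma weight_average:
  assumes "finite X" "S \<subseteq> X" "T \<subseteq> X" "S \<inter> T = {}" "T \<noteq> {}"
  shows "(\<Sum>x\<in>X - S. 1 / real (card S + card (T - {x}) choose card S))
    = real (card X) / real (card S + card T choose card S)"
proof -
  have fin: "finite S" "finite T"
    using assms finite_subset by blast+
  define s t c where "s = card S" and "t = card T" and "c = real (s + t choose s)"
  have t: "t > 0"
    using assms fin by (simp add: t_def card_gt_0_iff)
  have c: "c > 0"
    by (simp add: c_def)
  have XS: "X - S = (X - S - T) \<union> T"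
    using assms by auto
  have "card (X - S - T) = card (X - (S \<union> T))"
    by (rule arg_cong[of _ _ card]) auto
  also have "\<dots> = card X - s - t"
    using assms fin by (simp add: card_Diff_subset card_Un_disjoint s_def t_def)
  finally have "card (X - S - T) = card X - s - t" .
  moreover have "s + t \<le> card X"
    using assms fin card_mono[of X "S \<union> T"] by (simp add: card_Un_disjoint s_def t_def)
  ultimately have rest: "real (card (X - S - T)) = real (card X) - s - t"
    by simp
  have "(s + t) * (s + (t - 1) choose s) = t * (s + t choose s)"
  proof -
    obtain u where u: "t = Suc u"
      using t by (cases t) auto
    have "Suc u * (Suc (s + u) choose Suc u) = Suc (s + u) * ((s + u) choose u)"
      by (rule Suc_times_binomial_eq[symmetric, of "s + u" u, simplified mult.commute])
    moreover have "(Suc (s + u) choose Suc u) = (Suc (s + u) choose s)" "((s + u) choose u) = ((s + u) choose s)"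
      using binomial_symmetric[of s "Suc (s + u)"] binomial_symmetric[of s "s + u"] by simp_all
    ultimately show ?thesis
      using u by simp
  qed
  then have "real (s + t) * real (s + (t - 1) choose s) = real t * c"
    unfolding c_def by (metis of_nat_mult)
  moreover have "real (s + (t - 1) choose s) > 0"
    by simp
  ultimately have del: "1 / real (s + (t - 1) choose s) = (real s + real t) / (real t * c)"
    using t c by (simp add: field_simps)
  have "(\<Sum>x\<in>X - S. 1 / real (card S + card (T - {x}) choose card S))
      = (\<Sum>x\<in>X - S - T. 1 / real (card S + card (T - {x}) choose card S))
        + (\<Sum>x\<in>T. 1 / real (card S + card (T - {x}) choose card S))"
    by (subst XS, rule sum.union_disjoint) (use assms fin in auto)
  also have "(\<Sum>x\<in>X - S - T. 1 / real (card S + card (T - {x}) choose card S)) = (\<Sum>x\<in>X - S - T. 1 / c)"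
    by (rule sum.cong) (auto simp: c_def s_def t_def)
  also have "(\<Sum>x\<in>T. 1 / real (card S + card (T - {x}) choose card S)) = (\<Sum>x\<in>T. (real s + real t) / (real t * c))"
    using del by (intro sum.cong) (auto simp: s_def t_def)
  finally show ?thesis
    using t c rest unfolding c_def[symmetric] s_def[symmetric] t_def[symmetric]
    by (simp add: t_def[symmetric] s_def[symmetric] field_simps)
qed

lemma pair_weight_average:
  assumes "finite I" "finite X" "\<And>i. i \<in> I \<Longrightarrow> A i \<subseteq> X \<and> B i \<subseteq> X" "cross_pairs I A B"
    and "\<And>i. i \<in> I \<Longrightarrow> B i \<noteq> {}"
  shows "(\<Sum>x\<in>X. pair_weight {i \<in> I. x \<notin> A i} A (\<lambda>i. B i - {x})) = real (card X) * pair_weight I A B"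
proof -
  let ?w = "\<lambda>i x. 1 / real (card (A i) + card (B i - {x}) choose card (A i))"
  have "(\<Sum>x\<in>X. pair_weight {i \<in> I. x \<notin> A i} A (\<lambda>i. B i - {x})) = (\<Sum>x\<in>X. \<Sum>i | i \<in> I \<and> x \<notin> A i. ?w i x)"
    by (simp add: pair_weight_def)
  also have "\<dots> = (\<Sum>i\<in>I. \<Sum>x | x \<in> X \<and> x \<notin> A i. ?w i x)"
    using assms by (intro sum.swap_restrict) auto
  also have "\<dots> = (\<Sum>i\<in>I. real (card X) / real (card (A i) + card (B i) choose card (A i)))"
  proof (rule sum.cong)
    fix i assume i: "i \<in> I"
    have "{x. x \<in> X \<and> x \<notin> A i} = X - A i"
      by auto
    then show "(\<Sum>x | x \<in> X \<and> x \<notin> A i. ?w i x) = real (card X) / real (card (A i) + card (B i) choose card (A i))"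
      using weight_average[of X "A i" "B i"] assms i by (auto simp: cross_pairs_def)
  qed simp
  also have "\<dots> = real (card X) * pair_weight I A B"
    by (simp add: pair_weight_def sum_distrib_left)
  finally show ?thesis .
qed

text \<open>By averaging, the weight is the mean over \<open>x\<close> of the weights after deleting
  \<open>x\<close>, and these are at most 1 by induction on the ground set. An empty
  \<open>B i\<close> stops the averaging, but then \<open>i\<close> is the only index.\<close>

theorem bollobas_weighted:
  assumes "finite I" "finite X" "\<And>i. i \<in> I \<Longrightarrow> A i \<subseteq> X \<and> B i \<subseteq> X" "cross_pairs I A B"
  shows "pair_weight I A B \<le> 1"
  using assms(2,1,3,4)
proof (induction "card X" arbitrary: X I B)
  case 0
  then have empty: "B i = {}" if "i \<in> I" for i
    using that by auto
  show ?case
  proof (cases "I = {}")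
    case False
    then obtain i where "i \<in> I"
      by blast
    then have "I = {i}" "B i = {}"
      using 0 empty cross_pairs_empty by metis+
    then show ?thesis
      by (simp add: pair_weight_def)
  qed (simp add: pair_weight_def)
next
  case (Suc n)
  show ?case
  proof (cases "\<exists>i\<in>I. B i = {}")
    case True
    then obtain i where "i \<in> I" "B i = {}"
      by blast
    then have "I = {i}" "B i = {}"
      using Suc cross_pairs_empty by metis+
    then show ?thesis
      by (simp add: pair_weight_def)
  next
    case False
    have "pair_weight {i \<in> I. x \<notin> A i} A (\<lambda>i. B i - {x}) \<le> 1" if "x \<in> X" for x
    proof (rule Suc.hyps(1)[of "X - {x}"])
      show "n = card (X - {x})"
        using Suc.hyps(2) that by simp
      show "cross_pairs {i \<in> I. x \<notin> A i} A (\<lambda>i. B i - {x})"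
        by (rule cross_pairs_delete) (rule Suc.prems)
    qed (use Suc.prems that in auto)
    then have "(\<Sum>x\<in>X. pair_weight {i \<in> I. x \<notin> A i} A (\<lambda>i. B i - {x})) \<le> real (card X)"
      using sum_bounded_above[of X _ "1::real"] by simp
    moreover have "(\<Sum>x\<in>X. pair_weight {i \<in> I. x \<notin> A i} A (\<lambda>i. B i - {x})) = real (card X) * pair_weight I A B"
      using Suc.prems False by (intro pair_weight_average) auto
    moreover have "real (card X) > 0"
      using Suc.hyps(2) by simp
    ultimately show ?thesis
      by (simp add: mult_le_cancel_left1)
  qed
qed

section \<open>Equality in Bollobas' inequality\<close>

lemma pair_weight_delete_tight:
  assumes "finite I" "finite X" "\<And>i. i \<in> I \<Longrightarrow> A i \<subseteq> X \<and> B i \<subseteq> X" "cross_pairs I A B"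
    and "\<And>i. i \<in> I \<Longrightarrow> B i \<noteq> {}" and "pair_weight I A B = 1" and "x \<in> X"
  shows "pair_weight {i \<in> I. x \<notin> A i} A (\<lambda>i. B i - {x}) = 1"
proof -
  let ?p = "\<lambda>x. pair_weight {i \<in> I. x \<notin> A i} A (\<lambda>i. B i - {x})"
  have le: "?p x \<le> 1" for x
  proof (rule bollobas_weighted[of _ X])
    show "cross_pairs {i \<in> I. x \<notin> A i} A (\<lambda>i. B i - {x})"
      by (rule cross_pairs_delete) (rule assms)
  qed (use assms in auto)
  \<comment> \<open>Numbers that are at most 1 and have mean 1 are all equal to 1.\<close>
  have "(\<Sum>x\<in>X. 1 - ?p x) = 0"
    using pair_weight_average[OF assms(1-5)] assms(6) by (simp add: sum_subtractf)
  then show ?thesis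
    using sum_nonneg_eq_0_iff[of X "\<lambda>x. 1 - ?p x"] assms(2,7) le by simp
qed

text \<open>Points of \<open>D\<close> are deleted one at a time; as no \<open>B i\<close> is
  contained in \<open>D\<close>, no second set becomes empty on the way.\<close>

lemma pair_weight_delete_set_tight:
  assumes "finite D" "finite I" "finite X" "\<And>i. i \<in> I \<Longrightarrow> A i \<subseteq> X \<and> B i \<subseteq> X" "cross_pairs I A B"
    and "pair_weight I A B = 1" and "D \<subseteq> X"
    and "\<And>i. i \<in> I \<Longrightarrow> \<not> B i \<subseteq> D"
  shows "pair_weight {i \<in> I. A i \<inter> D = {}} A (\<lambda>i. B i - D) = 1"
  using assms(1,7,8)
proof (induction D rule: finite_induct)
  case empty
  then show ?case
    using assms by simp
next
  case (insert x D)
  let ?I = "{i \<in> I. A i \<inter> D = {}}"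
  have "pair_weight {i \<in> ?I. x \<notin> A i} A (\<lambda>i. B i - D - {x}) = 1"
  proof (rule pair_weight_delete_tight[of _ X])
    show "cross_pairs ?I A (\<lambda>i. B i - D)"
    proof -
      have "A i \<inter> (B j - D) = A i \<inter> B j" if "i \<in> ?I" for i j
        using that by auto
      then show ?thesis
        using assms(5) by (simp add: cross_pairs_def)
    qed
    show "\<And>i. i \<in> ?I \<Longrightarrow> B i - D \<noteq> {}"
      using insert.prems by blast
    show "pair_weight ?I A (\<lambda>i. B i - D) = 1"
      using insert by auto
  qed (use assms(2-5) insert.prems in auto)
  moreover have "{i \<in> ?I. x \<notin> A i} = {i \<in> I. A i \<inter> insert x D = {}}" "(\<lambda>i. B i - D - {x}) = (\<lambda>i. B i - insert x D)"
    by auto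
  ultimately show ?case
    by simp
qed

text \<open>Everything outside \<open>Z = insert z (A i)\<close> is deleted. Tightness survives
  since each \<open>B j\<close> meets \<open>Z\<close>: \<open>B i\<close> in \<open>z\<close>, the
  others in \<open>A i\<close>. The remaining \<open>A j\<close> are \<open>a\<close>-subsets of the
  \<open>(a + 1)\<close>-set \<open>Z\<close>, and the trimmed \<open>B j\<close> are singletons, so
  each pair weighs \<open>1 / (a + 1)\<close>. Total weight 1 therefore means that every
  \<open>a\<close>-subset of \<open>Z\<close> occurs.\<close>

lemma tight_exchange:
  assumes "finite I" "cross_pairs I A B"
    and AB: "\<And>i. i \<in> I \<Longrightarrow> finite (A i) \<and> finite (B i)" and a: "\<And>i. i \<in> I \<Longrightarrow> card (A i) = a"
    and tight: "pair_weight I A B = 1"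
    and i: "i \<in> I" and y: "y \<in> A i" and z: "z \<in> B i"
  shows "\<exists>k\<in>I. A k = insert z (A i - {y})"
proof -
  define X where "X = (\<Union>i\<in>I. A i \<union> B i)"
  define Z where "Z = insert z (A i)"
  have fin: "finite X"
    using assms unfolding X_def by auto
  have zA: "z \<notin> A i"
    using assms unfolding cross_pairs_def by blast
  have ZX: "Z \<subseteq> X" "finite Z" "card Z = a + 1"
    using i z zA a AB unfolding X_def Z_def by auto
  let ?J = "{j \<in> I. A j \<subseteq> Z}"
  have cross: "A j \<inter> B l \<noteq> {}" if "j \<in> I" "l \<in> I" "j \<noteq> l" for j l
    using that assms(2) by (auto simp: cross_pairs_def)
  have cross0: "A j \<inter> B j = {}" if "j \<in> I" for j
    using that assms(2) by (auto simp: cross_pairs_def)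
  have meet: "B j \<inter> Z \<noteq> {}" if "j \<in> I" for j
    using cross[OF i that] z unfolding Z_def by (cases "i = j") auto
  have "pair_weight {j \<in> I. A j \<inter> (X - Z) = {}} A (\<lambda>j. B j - (X - Z)) = 1"
  proof (rule pair_weight_delete_set_tight[of _ _ X])
    show "\<And>j. j \<in> I \<Longrightarrow> \<not> B j \<subseteq> X - Z"
      using meet by blast
  qed (use assms fin in \<open>auto simp: X_def\<close>)
  moreover have "{j \<in> I. A j \<inter> (X - Z) = {}} = ?J"
    by (auto simp: X_def)
  ultimately have "pair_weight ?J A (\<lambda>j. B j - (X - Z)) = 1"
    by simp
  moreover have "card (B j - (X - Z)) = 1" if j: "j \<in> ?J" for j
  proof -
    have eq: "B j - (X - Z) = B j \<inter> Z"
      using j by (auto simp: X_def)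
    have "B j \<inter> Z \<subseteq> Z - A j"
      using cross0 j by auto
    moreover have "card (Z - A j) = 1"
      using j ZX a AB by (simp add: card_Diff_subset)
    ultimately have "card (B j \<inter> Z) \<le> 1"
      using ZX by (metis card_mono finite_Diff)
    moreover have "card (B j \<inter> Z) \<noteq> 0"
      using meet[of j] j ZX by auto
    ultimately show ?thesis
      using eq by simp
  qed
  ultimately have "real (card ?J) / real (a + 1) = 1"
    using a unfolding pair_weight_def by (simp add: add.commute)
  then have cJ: "card ?J = a + 1"
    by (simp add: field_simps del: of_nat_add of_nat_Suc)
  have inj: "inj_on A ?J"
    using cross0 cross by (intro inj_onI) (metis (no_types, lifting) mem_Collect_eq)
  have sub: "A ` ?J \<subseteq> ksub Z a"
    using a by (auto simp: ksub_def)
  have "A ` ?J = ksub Z a"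
  proof (rule card_subset_eq[OF finite_ksub[OF ZX(2)] sub])
    show "card (A ` ?J) = card (ksub Z a)"
      using ZX cJ by (simp add: card_image[OF inj] card_ksub)
  qed
  then have image: "ksub Z a = A ` ?J" ..
  have "card (insert z (A i - {y})) = a"
    using a[OF i] AB[OF i] card_swap[OF _ y zA] by simp
  then have "insert z (A i - {y}) \<in> ksub Z a"
    unfolding ksub_def Z_def by blast
  then show ?thesis
    unfolding image by auto
qed

text \<open>Exchange is available on both sides: exchanging \<open>x\<close> and \<open>y\<close> in
  a pair \<open>j\<close> yields some \<open>A k\<close> and some \<open>B l\<close>. These two sets
  are disjoint, which forces \<open>k = l\<close>, so the new pair has the same union. Hence all
  \<open>a\<close>-subsets of \<open>Y\<close> occur with their complements in \<open>Y\<close>, and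
  counting leaves no other pair.\<close>

theorem bollobas_uniform_tight:
  assumes "finite I" "cross_pairs I A B"
    and A: "\<And>i. i \<in> I \<Longrightarrow> finite (A i) \<and> card (A i) = a"
    and B: "\<And>i. i \<in> I \<Longrightarrow> finite (B i) \<and> card (B i) = b"
    and card: "card I = (a + b) choose a"
    and i: "i \<in> I"
    and j: "j \<in> I"
  shows "A j \<union> B j = A i \<union> B i"
proof -
  define Y where "Y = A i \<union> B i"
  have cross0: "A j \<inter> B j = {}" if "j \<in> I" for j
    using that assms(2) by (auto simp: cross_pairs_def)
  have Y: "finite Y" "card Y = a + b"
    using A[OF i] B[OF i] cross0[OF i] unfolding Y_def by (auto simp: card_Un_disjoint)
  have tight: "pair_weight I A B = 1" "pair_weight I B A = 1"
    using A B card binomial_symmetric[of a "a + b"] by (simp_all add: pair_weight_def add.commute)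
  let ?P = "\<lambda>T. \<exists>j\<in>I. A j = T \<and> B j = Y - T"
  have all: "?P T" if T: "T \<in> ksub Y a" for T
  proof (rule swap_induct[of T "A i" a Y ?P])
    show "?P (A i)"
      using i cross0[OF i] unfolding Y_def by auto
  next
    fix T x y assume T: "T \<subseteq> Y" "card T = a" "?P T" "x \<in> T" "y \<in> Y - T"
    then obtain j where j: "j \<in> I" "A j = T" "B j = Y - T"
      by blast
    obtain k where k: "k \<in> I" "A k = insert y (A j - {x})"
      using tight_exchange[OF assms(1,2) _ _ tight(1) j(1), of a x y] A B j T by auto
    obtain l where l: "l \<in> I" "B l = insert x (B j - {y})"
      using tight_exchange[OF assms(1) cross_pairs_swap[OF assms(2)] _ _ tight(2) j(1), of b y x] A B j T by auto
    have "A k \<inter> B l = {}"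
      using k l j T by auto
    moreover have "A k \<inter> B l = {} \<longleftrightarrow> k = l"
      using k(1) l(1) assms(2) unfolding cross_pairs_def by blast
    ultimately have "k = l"
      by blast
    then show "?P (insert y (T - {x}))"
      using k l j T by (intro bexI[of _ k]) auto
  qed (use T Y A[OF i] in \<open>auto simp: ksub_def Y_def intro: finite_subset\<close>)
  have inj: "inj_on A I"
    using assms(2) by (intro inj_onI) (metis cross_pairs_def)
  have "ksub Y a \<subseteq> A ` I"
    using all by force
  then have eq: "ksub Y a = A ` I"
    using assms(1) Y card by (intro card_subset_eq) (auto simp: card_image[OF inj] card_ksub)
  then obtain l where l: "l \<in> I" "A l = A j" "B l = Y - A j"
    using all[of "A j"] j by blast
  then have "l = j"
    using inj j by (auto dest: inj_onD)
  moreover have "A j \<subseteq> Y"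
    using eq j by (auto simp: ksub_def)
  ultimately show "A j \<union> B j = A i \<union> B i"
    using l by (auto simp: Y_def)
qed

section \<open>The exterior algebra in characteristic two\<close>

text \<open>Elements of \<open>'k ext\<close> are vectors in the basis \<open>e\<^sub>S\<close> indexed by finite sets \<open>S\<close>, with
  \<open>e\<^sub>S e\<^sub>T = e\<^bsub>S \<union> T\<^esub>\<close> for disjoint \<open>S\<close>, \<open>T\<close> and \<open>0\<close> otherwise. In characteristic two there are no signs,
  so this commutative ring is the exterior algebra.\<close>

typedef (overloaded) 'k ext = "{f :: nat set \<Rightarrow> 'k::zero. \<forall>S. infinite S \<longrightarrow> f S = 0}"
  morphisms coef Abs_ext
  by (rule exI[of _ "\<lambda>_. 0"]) simp

setup_lifting type_definition_ext

lemma ext_eqI: "(\<And>S. finite S \<Longrightarrow> coef f S = coef g S) \<Longrightarrow> f = g"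
  by transfer (auto simp: fun_eq_iff, metis)

lemma sum_Pow_Compl:
  "(\<Sum>S\<in>Pow R. f S (R - S)) = (\<Sum>S\<in>Pow R. f (R - S) S)"
  by (rule sum.reindex_bij_witness[of _ "\<lambda>S. R - S" "\<lambda>S. R - S"]) (auto simp: double_diff)

text \<open>Both sides sum over ordered partitions of \<open>R\<close> into three blocks.\<close>

lemma sum_Pow_assoc:
  fixes f g h :: "'a set \<Rightarrow> 'b::comm_ring_1"
  assumes "finite R"
  shows "(\<Sum>S\<in>Pow R. (\<Sum>T\<in>Pow S. f T * g (S - T)) * h (R - S))
    = (\<Sum>T\<in>Pow R. f T * (\<Sum>U\<in>Pow (R - T). g U * h (R - T - U)))"
proof -
  have "(\<Sum>S\<in>Pow R. (\<Sum>T\<in>Pow S. f T * g (S - T)) * h (R - S))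
      = (\<Sum>(S, T)\<in>Sigma (Pow R) Pow. f T * g (S - T) * h (R - S))"
    using assms by (subst sum.Sigma[symmetric]) (auto simp: sum_distrib_right intro: finite_subset)
  also have "\<dots> = (\<Sum>(T, U)\<in>Sigma (Pow R) (\<lambda>T. Pow (R - T)). f T * (g U * h (R - T - U)))"
    by (rule sum.reindex_bij_witness[of _ "\<lambda>(T, U). (T \<union> U, T)" "\<lambda>(S, T). (T, S - T)"])
      (auto simp: mult.assoc Un_Diff_cancel Un_absorb1 Diff_eq Int_Un_distrib intro!: arg_cong2[of _ _ _ _ "(*)"] arg_cong[of _ _ h] arg_cong[of _ _ g])
  also have "\<dots> = (\<Sum>T\<in>Pow R. f T * (\<Sum>U\<in>Pow (R - T). g U * h (R - T - U)))"
    using assms by (subst sum.Sigma[symmetric]) (auto simp: sum_distrib_left)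
  finally show ?thesis .
qed

instantiation ext :: (comm_ring_1) comm_ring_1
begin

lift_definition zero_ext :: "'a ext" is "\<lambda>_. 0" by simp
lift_definition one_ext :: "'a ext" is "\<lambda>S. if S = {} then 1 else 0" by auto
lift_definition plus_ext :: "'a ext \<Rightarrow> 'a ext \<Rightarrow> 'a ext" is "\<lambda>f g S. f S + g S" by simp
lift_definition minus_ext :: "'a ext \<Rightarrow> 'a ext \<Rightarrow> 'a ext" is "\<lambda>f g S. f S - g S" by simp
lift_definition uminus_ext :: "'a ext \<Rightarrow> 'a ext" is "\<lambda>f S. - f S" by simp
text \<open>This is subset convolution. For infinite \<open>R\<close> the index set
  \<open>Pow R\<close> is infinite and the sum defaults to 0, as membership in the type
  demands.\<close>

lift_definition times_ext :: "'a ext \<Rightarrow> 'a ext \<Rightarrow> 'a ext"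
  is "\<lambda>f g R. \<Sum>S\<in>Pow R. f S * g (R - S)" by simp

instance
proof
  fix f g h :: "'a ext"
  show "f * g * h = f * (g * h)"
    by (rule ext_eqI) (transfer, rule sum_Pow_assoc)
  show "f * g = g * f"
    by (rule ext_eqI, transfer, subst sum_Pow_Compl) (simp add: mult.commute)
  show "1 * f = f"
  proof (rule ext_eqI, transfer)
    fix f :: "nat set \<Rightarrow> 'a" and R :: "nat set"
    assume "finite R"
    then have "(\<Sum>S\<in>Pow R. (if S = {} then 1 else 0) * f (R - S)) = (\<Sum>S\<in>Pow R. if S = {} then f R else 0)"
      by (intro sum.cong) auto
    then show "(\<Sum>S\<in>Pow R. (if S = {} then 1 else 0) * f (R - S)) = f R"
      using \<open>finite R\<close> by simp
  qed
  show "(f + g) * h = f * h + g * h"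
    by transfer (simp add: distrib_right sum.distrib)
  show "(0 :: 'a ext) \<noteq> 1"
    by transfer (metis zero_neq_one)
qed (transfer; simp add: algebra_simps)+

end

lemma coef_mult: "coef (f * g) R = (\<Sum>S\<in>Pow R. coef f S * coef g (R - S))"
  by transfer simp

lemma coef_zero [simp]: "coef 0 S = 0"
  by transfer simp

lemma coef_plus [simp]: "coef (f + g) S = coef f S + coef g S"
  by transfer simp

lemma coef_minus [simp]: "coef (f - g) S = coef f S - coef g S"
  by transfer simp

lemma coef_sum: "coef (\<Sum>i\<in>I. f i) S = (\<Sum>i\<in>I. coef (f i) S)"
  by (induction I rule: infinite_finite_induct) auto

lift_definition ext_scale :: "'k::comm_ring_1 \<Rightarrow> 'k ext \<Rightarrow> 'k ext" is "\<lambda>c f S. c * f S" by simp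

lemma coef_scl [simp]: "coef (ext_scale c f) S = c * coef f S"
  by transfer simp

interpretation ext: vector_space "ext_scale :: 'k::field \<Rightarrow> 'k ext \<Rightarrow> 'k ext"
  by standard (auto intro!: ext_eqI simp: algebra_simps)

lemma scl_mult: "ext_scale c f * g = ext_scale c (f * g)" "f * ext_scale c g = ext_scale c (f * g)"
  by (rule ext_eqI, simp add: coef_mult sum_distrib_left, rule sum.cong, simp_all)+

lift_definition ext_monom :: "nat set \<Rightarrow> 'k::comm_ring_1 ext" is "\<lambda>S R. if finite R \<and> R = S then 1 else 0" by auto

lemma coef_mono: "finite S \<Longrightarrow> coef (ext_monom S) R = (if R = S then 1 else 0)"
  by transfer auto

lemma coef_mult_mono:
  assumes "finite S" "finite R"
  shows "coef (f * ext_monom S) R = (if S \<subseteq> R then coef f (R - S) else 0)"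
proof -
  have "coef (f * ext_monom S) R = (\<Sum>T\<in>Pow R. if T = R - S \<and> S \<subseteq> R then coef f T else 0)"
    unfolding coef_mult using assms by (intro sum.cong) (auto simp: coef_mono double_diff)
  also have "\<dots> = (\<Sum>T\<in>Pow R. if T = R - S then (if S \<subseteq> R then coef f T else 0) else 0)"
    by (intro sum.cong) auto
  also have "\<dots> = (if S \<subseteq> R then coef f (R - S) else 0)"
    using assms by (subst sum.delta) auto
  finally show ?thesis .
qed

lemma mono_mult:
  assumes "finite S" "finite T"
  shows "ext_monom S * ext_monom T = (if S \<inter> T = {} then ext_monom (S \<union> T) else 0)"
  by (rule ext_eqI) (use assms in \<open>auto simp: coef_mult_mono coef_mono\<close>)

text \<open>The homogeneous component of degree \<open>a\<close> in the exterior algebra on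
  \<open>n\<close> generators.\<close>

definition ext_hom :: "nat \<Rightarrow> nat \<Rightarrow> 'k::comm_ring_1 ext set"
  where "ext_hom n a = {f. \<forall>S. coef f S \<noteq> 0 \<longrightarrow> S \<in> ksub {..<n} a}"

lemma homD: "f \<in> ext_hom n a \<Longrightarrow> coef f S \<noteq> 0 \<Longrightarrow> S \<in> ksub {..<n} a"
  by (simp add: ext_hom_def)

lemma hom_coef0: "f \<in> ext_hom n a \<Longrightarrow> S \<notin> ksub {..<n} a \<Longrightarrow> coef f S = 0"
  by (auto simp: ext_hom_def)

lemma subspace_hom: "ext.subspace (ext_hom n a)"
proof (rule ext.subspaceI)
  fix f g :: "'a ext" assume fg: "f \<in> ext_hom n a" "g \<in> ext_hom n a"
  show "f + g \<in> ext_hom n a"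
    unfolding ext_hom_def
  proof (intro CollectI allI impI)
    fix S assume "coef (f + g) S \<noteq> 0"
    then have "coef f S \<noteq> 0 \<or> coef g S \<noteq> 0"
      by auto
    then show "S \<in> ksub {..<n} a"
      using fg homD by blast
  qed
qed (simp_all add: ext_hom_def)

lemma hom_mult:
  assumes "f \<in> ext_hom n a" "g \<in> ext_hom n b"
  shows "f * g \<in> ext_hom n (a + b)"
  unfolding ext_hom_def
proof (intro CollectI allI impI)
  fix R assume "coef (f * g) R \<noteq> 0"
  then obtain S where S: "S \<subseteq> R" "coef f S * coef g (R - S) \<noteq> 0"
    unfolding coef_mult by (meson PowD sum.neutral)
  then have "coef f S \<noteq> 0" "coef g (R - S) \<noteq> 0"
    by auto
  then have *: "S \<in> ksub {..<n} a" "R - S \<in> ksub {..<n} b"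
    using assms homD by blast+
  then have "finite S" "finite (R - S)"
    using ksub_finite by blast+
  moreover have "R = S \<union> (R - S)"
    using S by auto
  ultimately have "card R = card S + card (R - S)"
    by (metis Diff_disjoint card_Un_disjoint)
  then show "R \<in> ksub {..<n} (a + b)"
    using * S by (auto simp: ksub_def)
qed

lemma span_mult:
  assumes "f \<in> ext.span S" "g \<in> ext.span T" "ext.subspace W"
    and "\<And>s t. s \<in> S \<Longrightarrow> t \<in> T \<Longrightarrow> s * t \<in> W"
  shows "f * g \<in> W"
proof -
  have 1: "s * g \<in> W" if "s \<in> S" for s
    using assms(2)
  proof (induction rule: ext.span_induct_alt)
    case base
    then show ?case
      using assms(3) ext.subspace_0 by simp
  next
    case (step c x y)
    then show ?case
      using assms(3) assms(4)[OF that] by (simp add: distrib_left scl_mult ext.subspace_add ext.subspace_scale)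
  qed
  show ?thesis
    using assms(1)
  proof (induction rule: ext.span_induct_alt)
    case base
    then show ?case
      using assms(3) ext.subspace_0 by simp
  next
    case (step c x y)
    then show ?case
      using assms(3) 1 by (simp add: distrib_right scl_mult ext.subspace_add ext.subspace_scale)
  qed
qed

lemma ext_double:
  fixes f :: "'k::comm_ring_1 ext"
  assumes two: "(1::'k) + 1 = 0"
  shows "f + f = 0"
proof (rule ext_eqI)
  fix S
  have "coef f S + coef f S = (1 + 1) * coef f S"
    by (simp only: distrib_right mult_1)
  then show "coef (f + f) S = coef 0 S"
    by (simp only: coef_plus coef_zero two mult_zero_left)
qed

lemma hom1_eq: 
  assumes "f \<in> ext_hom n 1"
  shows "f = (\<Sum>k<n. ext_scale (coef f {k}) (ext_monom {k}))"
proof (rule ext_eqI)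
  fix S :: "nat set"
  assume "finite S"
  have eq: "coef (\<Sum>k<n. ext_scale (coef f {k}) (ext_monom {k})) S = (\<Sum>k<n. if S = {k} then coef f {k} else 0)"
    unfolding coef_sum by (intro sum.cong) (auto simp: coef_mono)
  show "coef f S = coef (\<Sum>k<n. ext_scale (coef f {k}) (ext_monom {k})) S"
  proof (cases "\<exists>k<n. S = {k}")
    case True
    then show ?thesis
      unfolding eq by auto
  next
    case False
    then have "S \<notin> ksub {..<n} 1"
      by (auto simp: ksub_def card_1_singleton_iff)
    then show ?thesis
      unfolding eq using assms False by (auto simp: hom_coef0 intro!: sum.neutral[symmetric])
  qed
qed

text \<open>Squares of generators vanish, and every mixed term occurs twice, hence cancels in
  characteristic two.\<close>

lemma hom1_square:
  fixes f :: "'k::comm_ring_1 ext"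
  assumes "(1::'k) + 1 = 0" "f \<in> ext_hom n 1"
  shows "f * f = 0"
proof -
  have "(\<Sum>k\<in>I. ext_scale (c k) (ext_monom {k})) * (\<Sum>k\<in>I. ext_scale (c k) (ext_monom {k})) = (0 :: 'k ext)"
    if "finite I" for I :: "nat set" and c
    using that
  proof (induction I rule: finite_induct)
    case empty
    then show ?case by simp
  next
    case (insert i I)
    let ?s = "\<Sum>k\<in>I. ext_scale (c k) (ext_monom {k}) :: 'k ext" and ?i = "ext_scale (c i) (ext_monom {i}) :: 'k ext"
    have "(?i + ?s) * (?i + ?s) = ?i * ?i + (?i * ?s + ?i * ?s) + ?s * ?s"
      by (simp add: algebra_simps)
    also have "\<dots> = 0"
      using insert.IH by (simp only: ext_double[OF assms(1)]) (simp add: scl_mult mono_mult ext_eqI)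
    finally show ?case
      using insert by simp
  qed
  then show ?thesis
    using hom1_eq[OF assms(2)] by (metis finite_lessThan)
qed

section \<open>Self-annihilating subspaces\<close>

text \<open>The code \<open>set_encode S\<close> is the sum of \<open>2 ^ k\<close> over
  \<open>S\<close>. It orders finite sets totally and is additive on disjoint unions, so it serves
  as a monomial order.\<close>

definition lead_sets :: "'k::comm_ring_1 ext set \<Rightarrow> nat set set"
  where "lead_sets U = {S. \<exists>u\<in>U. coef u S \<noteq> 0 \<and> (\<forall>T. coef u T \<noteq> 0 \<longrightarrow> set_encode T \<le> set_encode S)}"

lemma lead_setsE:
  assumes "S \<in> lead_sets U" "U \<subseteq> ext_hom n a"
  obtains u where "u \<in> U" "coef u S \<noteq> 0" "\<And>T. coef u T \<noteq> 0 \<Longrightarrow> set_encode T \<le> set_encode S" "S \<in> ksub {..<n} a"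
  using assms unfolding lead_sets_def ext_hom_def by blast

lemma lead_sets_ksub: "U \<subseteq> ext_hom n a \<Longrightarrow> lead_sets U \<subseteq> ksub {..<n} a"
  by (auto elim!: lead_setsE)

lemma lead_sets_nonzero:
  assumes "U \<subseteq> ext_hom n a" "u \<in> U" "u \<noteq> 0"
  shows "\<exists>S\<in>lead_sets U. coef u S \<noteq> 0"
proof -
  let ?Z = "{S. coef u S \<noteq> 0}"
  have "?Z \<subseteq> ksub {..<n} a"
    using assms by (auto simp: ext_hom_def)
  then have "finite ?Z"
    using finite_ksub finite_subset by blast
  moreover have "?Z \<noteq> {}"
    using assms(3) ext_eqI[of u 0] by auto
  ultimately have "Max (set_encode ` ?Z) \<in> set_encode ` ?Z"
    by (intro Max_in) auto
  then obtain S where "S \<in> ?Z" and S: "Max (set_encode ` ?Z) = set_encode S"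
    by blast
  moreover have "set_encode T \<le> set_encode S" if "T \<in> ?Z" for T
    unfolding S[symmetric] using \<open>finite ?Z\<close> that by (intro Max_ge) auto
  ultimately show ?thesis
    using assms(2) unfolding lead_sets_def by blast
qed

text \<open>For disjoint leading sets \<open>S\<close> and \<open>T\<close>, the coefficient of the
  product at \<open>S \<union> T\<close> is a single term. All splittings of
  \<open>S \<union> T\<close> have the same total code, so in any other one some part exceeds the
  leading code of its factor.\<close>

lemma lead_sets_intersecting:
  fixes U :: "'k::idom ext set"
  assumes "U \<subseteq> ext_hom n a" "\<And>u v. u \<in> U \<Longrightarrow> v \<in> U \<Longrightarrow> u * v = 0"
  shows "intersecting (lead_sets U)"
  unfolding intersecting_def
proof (intro ballI notI)
  fix S T assume S: "S \<in> lead_sets U" and T: "T \<in> lead_sets U" and disj: "S \<inter> T = {}"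
  obtain u where u: "u \<in> U" "coef u S \<noteq> 0" "\<And>T. coef u T \<noteq> 0 \<Longrightarrow> set_encode T \<le> set_encode S" "S \<in> ksub {..<n} a"
    using lead_setsE[OF S assms(1)] by blast
  obtain v where v: "v \<in> U" "coef v T \<noteq> 0" "\<And>S. coef v S \<noteq> 0 \<Longrightarrow> set_encode S \<le> set_encode T" "T \<in> ksub {..<n} a"
    using lead_setsE[OF T assms(1)] by blast
  have fin: "finite S" "finite T"
    using u(4) v(4) ksub_finite by blast+
  have "coef u Z * coef v (S \<union> T - Z) = (if Z = S then coef u S * coef v T else 0)" if Z: "Z \<in> Pow (S \<union> T)" for Z
  proof (cases "Z = S")
    case True
    moreover have "S \<union> T - S = T"
      using disj by auto
    ultimately show ?thesis
      by simp
  next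
    case False
    have finZ: "finite Z" "finite (S \<union> T - Z)"
      using fin Z finite_subset by auto
    have "set_encode Z + set_encode (S \<union> T - Z) = set_encode (S \<union> T)"
      using fin Z by (simp add: set_encode_def sum.subset_diff[of Z "S \<union> T"] add.commute)
    also have "\<dots> = set_encode S + set_encode T"
      using fin disj by (simp add: set_encode_def sum.union_disjoint)
    finally have "set_encode Z + set_encode (S \<union> T - Z) = set_encode S + set_encode T" .
    moreover have "set_encode Z \<noteq> set_encode S"
      using False finZ fin by (simp add: set_encode_eq)
    ultimately have "\<not> (set_encode Z \<le> set_encode S \<and> set_encode (S \<union> T - Z) \<le> set_encode T)"
      by linarith
    then have "coef u Z = 0 \<or> coef v (S \<union> T - Z) = 0"
      using u(3) v(3) by blast
    then show ?thesis
      using False by auto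
  qed
  then have "coef (u * v) (S \<union> T) = (\<Sum>Z\<in>Pow (S \<union> T). if Z = S then coef u S * coef v T else 0)"
    unfolding coef_mult by (intro sum.cong) auto
  also have "\<dots> = coef u S * coef v T"
    using fin by (subst sum.delta) auto
  finally show False
    using u v assms(2) by auto
qed

text \<open>Reduced echelon form: going up in the code, the vector for \<open>S\<close> is cleared
  at all smaller leading sets. An element of \<open>U\<close> that vanishes at every leading set is
  zero, which gives the span.\<close>

lemma reduced_basis:
  fixes U :: "'k::field ext set"
  assumes U: "ext.subspace U" "U \<subseteq> ext_hom n a"
  obtains r where "\<And>S. S \<in> lead_sets U \<Longrightarrow> r S \<in> U"
    and "\<And>S T. S \<in> lead_sets U \<Longrightarrow> T \<in> lead_sets U \<Longrightarrow> coef (r S) T = (if S = T then 1 else 0)"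
    and "U \<subseteq> ext.span (r ` lead_sets U)"
proof -
  let ?F = "lead_sets U"
  have finF: "finite ?F"
    using lead_sets_ksub[OF U(2)] finite_ksub finite_subset by blast
  have fin: "finite S" if "S \<in> ?F" for S
    using lead_sets_ksub[OF U(2)] that ksub_finite by blast
  have ex: "\<exists>u\<in>U. \<forall>T\<in>?F. coef u T = (if S = T then 1 else 0)" if "S \<in> ?F" for S
    using that
  proof (induction "set_encode S" arbitrary: S rule: less_induct)
    case less
    obtain v where v: "v \<in> U" "coef v S \<noteq> 0" "\<And>T. coef v T \<noteq> 0 \<Longrightarrow> set_encode T \<le> set_encode S"
      using lead_setsE[OF less.prems U(2)] by blast
    define G where "G = {T \<in> ?F. set_encode T < set_encode S}"
    have "\<exists>u. \<forall>T\<in>G. u T \<in> U \<and> (\<forall>T'\<in>?F. coef (u T) T' = (if T = T' then 1 else 0))"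
    proof (rule bchoice)
      show "\<forall>T\<in>G. \<exists>u. u \<in> U \<and> (\<forall>T'\<in>?F. coef u T' = (if T = T' then 1 else 0))"
        using less.hyps by (simp add: G_def Bex_def)
    qed
    then obtain u where u: "\<And>T. T \<in> G \<Longrightarrow> u T \<in> U"
      "\<And>T T'. T \<in> G \<Longrightarrow> T' \<in> ?F \<Longrightarrow> coef (u T) T' = (if T = T' then 1 else 0)"
      by blast
    define w where "w = ext_scale (1 / coef v S) (v - (\<Sum>T\<in>G. ext_scale (coef v T) (u T)))"
    have "w \<in> U"
      unfolding w_def using U(1) v(1) u(1)
      by (intro ext.subspace_scale ext.subspace_diff ext.subspace_sum)
    moreover have "coef w T = (if S = T then 1 else 0)" if T: "T \<in> ?F" for T
    proof -
      have "(\<Sum>Z\<in>G. coef v Z * coef (u Z) T) = (\<Sum>Z\<in>G. if Z = T then coef v T else 0)"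
        using u(2) T by (intro sum.cong) auto
      also have "\<dots> = (if T \<in> G then coef v T else 0)"
        using finF by (subst sum.delta) (auto simp: G_def)
      finally have c: "coef w T = (1 / coef v S) * (coef v T - (if T \<in> G then coef v T else 0))"
        by (simp add: w_def coef_sum)
      consider "T = S" | "T \<in> G" "T \<noteq> S" | "set_encode S < set_encode T"
        using T less.prems fin unfolding G_def by (metis (mono_tags, lifting) linorder_neqE_nat mem_Collect_eq set_encode_eq)
      then show ?thesis
      proof cases
        case 3
        then have "coef v T = 0"
          using v(3)[of T] by (meson leD)
        then show ?thesis
          using c 3 by auto
      qed (use c v(2) in \<open>auto simp: G_def\<close>)
    qed
    ultimately show ?case
      by blast
  qed
  have "\<exists>r. \<forall>S\<in>?F. r S \<in> U \<and> (\<forall>T\<in>?F. coef (r S) T = (if S = T then 1 else 0))"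
    by (rule bchoice) (use ex in \<open>simp add: Bex_def\<close>)
  then obtain r where r: "\<And>S. S \<in> ?F \<Longrightarrow> r S \<in> U"
    "\<And>S T. S \<in> ?F \<Longrightarrow> T \<in> ?F \<Longrightarrow> coef (r S) T = (if S = T then 1 else 0)"
    by blast
  moreover have "u \<in> ext.span (r ` ?F)" if u: "u \<in> U" for u
  proof -
    define s where "s = (\<Sum>S\<in>?F. ext_scale (coef u S) (r S))"
    have "u - s \<in> U"
      unfolding s_def using U(1) u r(1)
      by (intro ext.subspace_diff ext.subspace_sum ext.subspace_scale)
    moreover have "coef (u - s) T = 0" if T: "T \<in> ?F" for T
    proof -
      have "(\<Sum>S\<in>?F. coef u S * coef (r S) T) = (\<Sum>S\<in>?F. if S = T then coef u T else 0)"
        using r(2) T by (intro sum.cong) auto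
      then show ?thesis
        using finF T by (simp add: s_def coef_sum)
    qed
    ultimately have "u - s = 0"
      using lead_sets_nonzero[OF U(2)] by blast
    moreover have "s \<in> ext.span (r ` ?F)"
      unfolding s_def by (intro ext.span_sum ext.span_scale ext.span_base imageI)
    ultimately show ?thesis
      by simp
  qed
  ultimately show ?thesis
    using that by blast
qed

text \<open>If the leading sets form the star of \<open>e\<close>, the coefficients of the reduced basis vectors outside this
  star turn out to be those of multiplication by a fixed vector.\<close>

theorem exterior_erdos_ko_rado_tight:
  fixes U :: "'k::field ext set"
  assumes two: "(1::'k) + 1 = 0"
    and U: "ext.subspace U" "U \<subseteq> ext_hom n a" "\<And>u v. u \<in> U \<Longrightarrow> v \<in> U \<Longrightarrow> u * v = 0"
    and n: "2 * a < n" and a: "a \<ge> 1"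
    and P: "P \<subseteq> U" "\<not> ext.dependent P" "card P = (n - 1) choose (a - 1)"
  shows "\<exists>v\<in>ext_hom n 1. v \<noteq> 0 \<and> (\<forall>u\<in>U. v * u = 0)"
proof -
  let ?F = "lead_sets U"
  obtain r where r: "\<And>S. S \<in> ?F \<Longrightarrow> r S \<in> U"
    "\<And>S T. S \<in> ?F \<Longrightarrow> T \<in> ?F \<Longrightarrow> coef (r S) T = (if S = T then 1 else 0)"
    "U \<subseteq> ext.span (r ` ?F)"
    using reduced_basis[OF U(1,2)] by blast
  have F: "?F \<subseteq> ksub {..<n} a" "intersecting ?F"
    using lead_sets_ksub lead_sets_intersecting U by blast+
  have finF: "finite ?F"
    using F(1) finite_ksub finite_subset by blast
  \<comment> \<open>An independent set is no larger than a finite spanning set. So the leading sets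
    are at least as many as \<open>P\<close>, and Erdos-Ko-Rado makes them an extremal
    family.\<close>
  have "card P \<le> card (r ` ?F)"
    using ext.independent_span_bound[of "r ` ?F" P] finF P r(3) by auto
  also have "\<dots> \<le> card ?F"
    using finF by (rule card_image_le)
  finally have "(n - 1) choose (a - 1) \<le> card ?F"
    using P by simp
  then have cardF: "card ?F = (n - 1) choose (a - 1)" and star: "\<exists>e\<in>{..<n}. \<forall>S\<in>?F. e \<in> S"
    using erdos_ko_rado[of "{..<n}" a ?F] F n a by auto
  then obtain e where e: "e < n" "\<And>S. S \<in> ?F \<Longrightarrow> e \<in> S"
    by auto
  have full: "?F = {S \<in> ksub {..<n} a. e \<in> S}"
    using star_unique[of "{..<n}" e a ?F] e a F cardF by auto
  define N where "N = {..<n} - {e}"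
  have N: "finite N" "card N = n - 1" "e \<notin> N" "insert e N = {..<n}"
    using e unfolding N_def by auto
  define c where "c T = coef (r (insert e T))" for T
  have mem: "insert e T \<in> ?F" if "T \<in> ksub N (a - 1)" for T
  proof -
    have "finite T" "T \<subseteq> N" "card T = a - 1"
      using that N(1) ksub_finite unfolding ksub_def by auto
    moreover have "e \<notin> T"
      using calculation N by auto
    ultimately have "card (insert e T) = a"
      using a by simp
    then show ?thesis
      unfolding full using \<open>T \<subseteq> N\<close> N e(1) by (auto simp: ksub_def)
  qed
  have ext_hom: "r (insert e T) \<in> ext_hom n a" if "T \<in> ksub N (a - 1)" for T
    using r(1) mem that U(2) by blast
  have c_ksub: "S \<in> ksub {..<n} a" if "c T S \<noteq> 0" "T \<in> ksub N (a - 1)" for T S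
    using homD[OF ext_hom[OF that(2)]] that(1) unfolding c_def by blast
  have c_star: "c T S = (if S = insert e T then 1 else 0)" if "T \<in> ksub N (a - 1)" "e \<in> S" for T S
  proof (cases "S \<in> ksub {..<n} a")
    case True
    then show ?thesis
      using r(2)[of "insert e T" S] mem that unfolding c_def full by auto
  next
    case False
    then show ?thesis
      using c_ksub[of T S] mem[OF that(1)] F(1) that by auto
  qed
  \<comment> \<open>This is the coefficient at \<open>insert e R\<close> of a product that vanishes.
    In each splitting exactly one part contains \<open>e\<close>, and there a reduced basis vector
    has just one nonzero coefficient.\<close>
  have relation: "(if S \<subseteq> R then c T (R - S) else 0) + (if T \<subseteq> R then c S (R - T) else 0) = 0"
    if S: "S \<in> ksub N (a - 1)" and T: "T \<in> ksub N (a - 1)" and R: "R \<subseteq> N" for S T R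
  proof -
    have eR: "e \<notin> R" "finite R"
      using R N finite_subset by auto
    have eST: "e \<notin> S" "e \<notin> T"
      using S T N(3) by (auto simp: ksub_def)
    have split: "Pow (insert e R) = insert e ` Pow R \<union> Pow R"
      unfolding Pow_insert by auto
    have "(0::'k) = coef (r (insert e S) * r (insert e T)) (insert e R)"
      using U(3) r(1) mem S T by simp
    also have "\<dots> = (\<Sum>Z\<in>Pow (insert e R). c S Z * c T (insert e R - Z))"
      unfolding coef_mult c_def ..
    also have "\<dots> = (\<Sum>Z\<in>insert e ` Pow R. c S Z * c T (insert e R - Z)) + (\<Sum>Z\<in>Pow R. c S Z * c T (insert e R - Z))"
      unfolding split using eR by (intro sum.union_disjoint) auto
    also have "(\<Sum>Z\<in>insert e ` Pow R. c S Z * c T (insert e R - Z)) = (\<Sum>Z\<in>Pow R. c S (insert e Z) * c T (R - Z))"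
    proof -
      have "inj_on (insert e) (Pow R)"
        using eR by (intro inj_onI) (metis PowD insert_ident subsetD)
      moreover have "insert e R - insert e Z = R - Z" for Z
        using eR by auto
      ultimately show ?thesis
        by (simp add: sum.reindex)
    qed
    also have "\<dots> = (\<Sum>Z\<in>Pow R. if Z = S then c T (R - S) else 0)"
    proof (rule sum.cong)
      fix Z assume "Z \<in> Pow R"
      then have "insert e Z = insert e S \<longleftrightarrow> Z = S"
        using eR eST by (metis PowD insert_ident subsetD)
      then show "c S (insert e Z) * c T (R - Z) = (if Z = S then c T (R - S) else 0)"
        using c_star[OF S, of "insert e Z"] by auto
    qed simp
    also have "\<dots> = (if S \<subseteq> R then c T (R - S) else 0)"
      using eR by (subst sum.delta) auto
    also have "(\<Sum>Z\<in>Pow R. c S Z * c T (insert e R - Z)) = (\<Sum>Z\<in>Pow R. if Z = R - T then (if T \<subseteq> R then c S (R - T) else 0) else 0)"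
    proof (rule sum.cong)
      fix Z assume Z: "Z \<in> Pow R"
      then have "insert e R - Z = insert e (R - Z)"
        using eR by auto
      moreover have "insert e (R - Z) = insert e T \<longleftrightarrow> R - Z = T"
        using eR eST by (metis DiffD1 insert_ident)
      moreover have "R - Z = T \<longleftrightarrow> Z = R - T \<and> T \<subseteq> R"
        using Z by auto
      ultimately show "c S Z * c T (insert e R - Z) = (if Z = R - T then (if T \<subseteq> R then c S (R - T) else 0) else 0)"
        using c_star[OF T, of "insert e R - Z"] by auto
    qed simp
    also have "\<dots> = (if T \<subseteq> R then c S (R - T) else 0)"
      using eR by (subst sum.delta) auto
    finally show ?thesis
      by simp
  qed
  \<comment> \<open>For \<open>t\<close> in \<open>T - Q\<close>, the bound \<open>2 * a < n\<close>
    leaves an \<open>(a - 1)\<close>-set \<open>S\<close> in \<open>N\<close> avoiding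
    \<open>Q\<close> and \<open>t\<close>. In the relation for \<open>R = S \<union> Q\<close> the
    second term drops out, as \<open>T\<close> is not contained in \<open>R\<close>, and
    \<open>c T Q = 0\<close> remains.\<close>
  have supp: "T \<subseteq> Q" if T: "T \<in> ksub N (a - 1)" and Q: "Q \<in> ksub N a" and nz: "c T Q \<noteq> 0" for T Q
  proof (rule ccontr)
    assume "\<not> T \<subseteq> Q"
    then obtain t where t: "t \<in> T" "t \<notin> Q"
      by blast
    have "finite Q" "Q \<subseteq> N" "card Q = a"
      using Q N(1) ksub_finite by (auto simp: ksub_def)
    moreover have "t \<in> N"
      using t T by (auto simp: ksub_def)
    ultimately have "card (N - insert t Q) = n - 1 - (a + 1)"
      using t N by (subst card_Diff_subset) auto
    then have "a - 1 \<le> card (N - insert t Q)"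
      using n by simp
    then obtain S where S: "S \<subseteq> N - insert t Q" "card S = a - 1"
      by (meson obtain_subset_with_card_n)
    have "(if S \<subseteq> S \<union> Q then c T (S \<union> Q - S) else 0) + (if T \<subseteq> S \<union> Q then c S (S \<union> Q - T) else 0) = 0"
      using S T \<open>Q \<subseteq> N\<close> by (intro relation) (auto simp: ksub_def)
    moreover have "\<not> T \<subseteq> S \<union> Q" "S \<union> Q - S = Q"
      using S t by auto
    ultimately show False
      using nz by simp
  qed
  \<comment> \<open>For disjoint \<open>S\<close> and \<open>S'\<close>, the relation at
    \<open>insert x (S \<union> S')\<close> says that the two coefficients add to 0, so they agree
    in characteristic two. Connectedness of the Kneser graph on \<open>N - {x}\<close> does the
    rest.\<close>
  have const: "c T (insert x T) = c T' (insert x T')"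
    if x: "x \<in> N" and T: "T \<in> ksub (N - {x}) (a - 1)" and T': "T' \<in> ksub (N - {x}) (a - 1)" for x T T'
  proof -
    have "c T' (insert x T') = c T (insert x T)"
    proof (rule kneser_connected[of "N - {x}" "a - 1" T "\<lambda>S. c S (insert x S) = c T (insert x T)"])
      show "2 * (a - 1) + 1 \<le> card (N - {x})"
        using x N n a by simp
    next
      fix S S' assume S: "S \<subseteq> N - {x}" "card S = a - 1" and S': "S' \<subseteq> N - {x}" "card S' = a - 1"
        and disj: "S \<inter> S' = {}" and eq: "c S (insert x S) = c T (insert x T)"
      let ?R = "insert x (S \<union> S')"
      have "(if S \<subseteq> ?R then c S' (?R - S) else 0) + (if S' \<subseteq> ?R then c S (?R - S') else 0) = 0"
        using S S' x by (intro relation) (auto simp: ksub_def)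
      moreover have "?R - S = insert x S'" "?R - S' = insert x S" "S \<subseteq> ?R" "S' \<subseteq> ?R"
        using S S' disj by auto
      ultimately have "c S' (insert x S') + c S (insert x S) = 0"
        by simp
      moreover have "c S (insert x S) + c S (insert x S) = 0"
        using two by (metis distrib_right mult_1 mult_zero_left)
      ultimately have "c S' (insert x S') = c S (insert x S)"
        by (metis add_right_cancel)
      then show "c S' (insert x S') = c T (insert x T)"
        using eq by simp
    qed (use T T' N in \<open>auto simp: ksub_def\<close>)
    then show ?thesis
      by simp
  qed
  have "\<exists>w. \<forall>x\<in>N. \<forall>T\<in>ksub (N - {x}) (a - 1). c T (insert x T) = w x"
  proof (rule bchoice, rule ballI)
    fix x assume x: "x \<in> N"
    show "\<exists>w. \<forall>T\<in>ksub (N - {x}) (a - 1). c T (insert x T) = w"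
      using const[OF x] by meson
  qed
  then obtain w where w: "\<And>x T. x \<in> N \<Longrightarrow> T \<in> ksub (N - {x}) (a - 1) \<Longrightarrow> c T (insert x T) = w x"
    by blast
  define v :: "'k ext" where "v = ext_monom {e} + (\<Sum>x\<in>N. ext_scale (w x) (ext_monom {x}))"
  have mono_hom: "ext_monom {x} \<in> ext_hom n 1" if "x < n" for x
    using that by (auto simp: ext_hom_def ksub_def coef_mono split: if_splits)
  have v_hom: "v \<in> ext_hom n 1"
    unfolding v_def using e(1) N
    by (intro ext.subspace_add[OF subspace_hom] ext.subspace_sum[OF subspace_hom] ext.subspace_scale[OF subspace_hom] mono_hom)
      auto
  have "coef (\<Sum>x\<in>N. ext_scale (w x) (ext_monom {x})) {e} = 0"
    using N(3) by (auto simp: coef_sum coef_mono intro!: sum.neutral)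
  then have v_e: "coef v {e} = 1"
    by (simp add: v_def coef_mono)
  have v_x: "coef v {x} = w x" if "x \<in> N" for x
  proof -
    have "coef (\<Sum>y\<in>N. ext_scale (w y) (ext_monom {y})) {x} = (\<Sum>y\<in>N. if y = x then w x else 0)"
      unfolding coef_sum by (intro sum.cong) (auto simp: coef_mono)
    then show ?thesis
      using that N by (auto simp: v_def coef_mono)
  qed
  \<comment> \<open>Coefficients at sets containing \<open>e\<close> are fixed by reducedness, those
    at \<open>insert x T\<close> by the choice of \<open>w\<close>. All others vanish: on the left
    by \<open>supp\<close>, on the right because \<open>v\<close> has degree one.\<close>
  have factor: "r (insert e T) = v * ext_monom T" if T: "T \<in> ksub N (a - 1)" for T
  proof (rule ext_eqI)
    fix R :: "nat set" assume R: "finite R"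
    have T': "finite T" "T \<subseteq> N" "card T = a - 1" "e \<notin> T"
      using T N ksub_finite by (auto simp: ksub_def)
    have rhs: "coef (v * ext_monom T) R = (if T \<subseteq> R then coef v (R - T) else 0)"
      using coef_mult_mono[OF T'(1) R] .
    show "coef (r (insert e T)) R = coef (v * ext_monom T) R"
    proof (cases "e \<in> R")
      case True
      have "(if T \<subseteq> R then coef v (R - T) else 0) = (if R = insert e T then 1 else 0)"
      proof (cases "R = insert e T")
        case eq: True
        then have "R - T = {e}"
          using T' by auto
        then show ?thesis
          using eq v_e by auto
      next
        case False
        have "coef v (R - T) = 0" if "T \<subseteq> R"
        proof (rule ccontr)
          assume "coef v (R - T) \<noteq> 0"
          then have "card (R - T) = 1"
            using homD[OF v_hom] by (auto simp: ksub_def)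
          then obtain x where "R - T = {x}"
            by (auto simp: card_1_singleton_iff)
          moreover have "e \<in> R - T"
            using True T'(4) by blast
          ultimately have "R - T = {e}"
            by (metis singletonD)
          then show False
            using False that by auto
        qed
        then show ?thesis
          using False by simp
      qed
      then show ?thesis
        using c_star[OF T True] rhs unfolding c_def by simp
    next
      case False
      show ?thesis
      proof (cases "\<exists>x\<in>N - T. R = insert x T")
        case True
        then obtain x where x: "x \<in> N" "x \<notin> T" "R = insert x T"
          by blast
        then have "R - T = {x}"
          by auto
        moreover have "c T R = w x"
          using w[OF x(1), of T] x T' by (auto simp: ksub_def)
        ultimately show ?thesis
          using rhs v_x[OF x(1)] x(3) unfolding c_def by auto
      next
        case no: False
        have l: "c T R = 0"
        proof (rule ccontr)
          assume nz: "c T R \<noteq> 0"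
          then have R': "R \<in> ksub {..<n} a"
            using c_ksub T by blast
          then have "R \<in> ksub N a"
            using False by (auto simp: ksub_def N_def)
          then have "T \<subseteq> R"
            using supp T nz by blast
          then have "card (R - T) = 1"
            using R' T' a by (simp add: card_Diff_subset ksub_def)
          then obtain x where "R - T = {x}"
            by (auto simp: card_1_singleton_iff)
          then have "x \<in> N - T" "R = insert x T"
            using \<open>T \<subseteq> R\<close> \<open>R \<in> ksub N a\<close> by (auto simp: ksub_def)
          then show False
            using no by blast
        qed
        have "coef v (R - T) = 0" if "T \<subseteq> R"
        proof (rule ccontr)
          assume "coef v (R - T) \<noteq> 0"
          then have "R - T \<in> ksub {..<n} 1"
            using homD[OF v_hom] by blast
          then obtain x where "R - T = {x}" "x < n"
            by (auto simp: ksub_def card_1_singleton_iff)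
          then have "x \<in> N - T" "R = insert x T"
            using that False by (auto simp: N_def)
          then show False
            using no by blast
        qed
        then show ?thesis
          using l rhs unfolding c_def by simp
      qed
    qed
  qed
  have "v * r S = 0" if S: "S \<in> ?F" for S
  proof -
    have "e \<in> S" "S - {e} \<in> ksub N (a - 1)" "insert e (S - {e}) = S"
      using S a unfolding full by (auto simp: ksub_def N_def)
    then have "v * r S = (v * v) * ext_monom (S - {e})"
      using factor[of "S - {e}"] by (simp add: mult.assoc)
    then show ?thesis
      using hom1_square[OF two v_hom] by simp
  qed
  then have "v * u = 0" if "u \<in> U" for u
    using span_mult[of v "{v}" u "r ` ?F" "{0}"] r(3) that ext.subspace_single_0 by (auto simp: ext.span_base)
  moreover have "v \<noteq> 0"
    using v_e by auto
  ultimately show ?thesis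
    using v_hom by blast
qed

section \<open>The moment curve\<close>

definition moment :: "nat \<Rightarrow> 'k::field \<Rightarrow> 'k ext"
  where "moment n c = (\<Sum>k<n. ext_scale (c ^ k) (ext_monom {k}))"

definition moment_prod :: "nat \<Rightarrow> 'k::field set \<Rightarrow> 'k ext"
  where "moment_prod n S = (\<Prod>c\<in>S. moment n c)"

lemma mono_hom1: "k < n \<Longrightarrow> ext_monom {k} \<in> ext_hom n 1"
  by (auto simp: ext_hom_def ksub_def coef_mono split: if_splits)

lemma moment_hom: "moment n c \<in> ext_hom n 1"
  unfolding moment_def
  by (intro ext.subspace_sum[OF subspace_hom] ext.subspace_scale[OF subspace_hom] mono_hom1) auto

lemma coef_moment: "k < n \<Longrightarrow> coef (moment n c) {k} = c ^ k"
  unfolding moment_def coef_sum by (simp add: coef_mono if_distrib cong: if_cong)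

lemma moment_prod_hom: "finite S \<Longrightarrow> moment_prod n S \<in> ext_hom n (card S)"
proof (induction S rule: finite_induct)
  case empty
  have "1 \<in> ext_hom n 0"
    by (auto simp: ext_hom_def ksub_def one_ext.rep_eq split: if_splits)
  then show ?case
    by (simp add: moment_prod_def)
next
  case (insert c S)
  then show ?case
    using hom_mult[OF moment_hom[of n c] insert.IH] by (simp add: moment_prod_def)
qed

lemma moment_prod_disjoint:
  "finite S \<Longrightarrow> finite T \<Longrightarrow> S \<inter> T = {} \<Longrightarrow> moment_prod n S * moment_prod n T = moment_prod n (S \<union> T)"
  by (simp add: moment_prod_def prod.union_disjoint)

lemma moment_mult_prod:
  assumes "(1::'k::field) + 1 = 0" "finite S"
  shows "moment n (c::'k) * moment_prod n S = (if c \<in> S then 0 else moment_prod n (insert c S))"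
proof (cases "c \<in> S")
  case True
  then have "moment n c * moment_prod n S = (moment n c * moment n c) * moment_prod n (S - {c})"
    using assms(2) by (simp add: moment_prod_def prod.remove[of S c] mult.assoc)
  then show ?thesis
    using True hom1_square[OF assms(1) moment_hom] by simp
qed (use assms in \<open>simp add: moment_prod_def\<close>)

lemma moment_prod_meet:
  assumes "(1::'k::field) + 1 = 0" "finite S" "finite T" "S \<inter> T \<noteq> {}"
  shows "moment_prod n S * moment_prod n (T :: 'k set) = 0"
proof -
  obtain c where c: "c \<in> S" "c \<in> T"
    using assms(4) by blast
  then have "moment_prod n S = moment_prod n (S - {c}) * moment n c"
    using assms(2) by (simp add: moment_prod_def prod.remove[of S c] mult.commute)
  then show ?thesis
    using moment_mult_prod[OF assms(1,3), of n c] c by (simp add: mult.assoc)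
qed

text \<open>Pairing the relation with the coefficients of a polynomial \<open>q\<close> that
  vanishes on \<open>C - {d}\<close> isolates the coefficient at \<open>d\<close>; \<open>q\<close>
  has degree below \<open>n\<close>, so only the available powers occur.\<close>

lemma moment_independent:
  assumes "finite C" "card C \<le> n" "(\<Sum>c\<in>C. ext_scale (\<mu> c) (moment n c)) = 0" "d \<in> C"
  shows "\<mu> d = (0::'k::field)"
proof -
  have power: "(\<Sum>c\<in>C. \<mu> c * c ^ k) = 0" if "k < n" for k
  proof -
    have "coef (\<Sum>c\<in>C. ext_scale (\<mu> c) (moment n c)) {k} = 0"
      using assms(3) by simp
    then show ?thesis
      using that by (simp add: coef_sum coef_moment)
  qed
  define q where "q = (\<Prod>c\<in>C - {d}. [:- c, 1:])"
  have "degree q \<le> (\<Sum>c\<in>C - {d}. degree [:- c, 1:])"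
    unfolding q_def using degree_prod_sum_le[of "C - {d}" "\<lambda>c. [:- c, 1:]"] assms(1) by (simp add: o_def)
  also have "\<dots> < n"
    using assms card_gt_0_iff[of C] by auto
  finally have deg: "degree q < n" .
  have "(\<Sum>c\<in>C. \<mu> c * poly q c) = (\<Sum>c\<in>C. \<Sum>k\<le>degree q. coeff q k * (\<mu> c * c ^ k))"
    by (simp add: poly_altdef sum_distrib_left mult_ac)
  also have "\<dots> = (\<Sum>k\<le>degree q. coeff q k * (\<Sum>c\<in>C. \<mu> c * c ^ k))"
    by (subst sum.swap) (simp add: sum_distrib_left)
  also have "\<dots> = 0"
    using power deg by (intro sum.neutral) auto
  finally have "(\<Sum>c\<in>C. \<mu> c * poly q c) = 0" .
  moreover have "(\<Sum>c\<in>C. \<mu> c * poly q c) = (\<Sum>c\<in>C. if c = d then \<mu> d * poly q d else 0)"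
  proof (rule sum.cong)
    fix c assume "c \<in> C"
    then show "\<mu> c * poly q c = (if c = d then \<mu> d * poly q d else 0)"
      using assms(1) unfolding q_def by (auto simp: poly_prod)
  qed simp
  ultimately have "\<mu> d * poly q d = 0"
    using assms by simp
  moreover have "poly q d \<noteq> 0"
    using assms(1) unfolding q_def by (auto simp: poly_prod)
  ultimately show ?thesis
    by simp
qed

lemma moment_span:
  assumes "finite C" "card C = n" "f \<in> ext_hom n 1"
  shows "f \<in> ext.span (moment n ` (C :: 'k::field set))"
proof -
  have inj: "inj_on (moment n) C"
  proof (rule inj_onI, rule ccontr)
    fix c d assume cd: "c \<in> C" "d \<in> C" "moment n c = moment n d" "c \<noteq> d"
    let ?m = "\<lambda>x. if x = c then 1 else if x = d then - 1 else (0::'k)"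
    have "(\<Sum>x\<in>{c, d}. ext_scale (?m x) (moment n x)) = 0"
      using cd by (simp add: ext_eqI)
    moreover have "card {c, d} \<le> n"
      using cd assms card_mono[of C "{c, d}"] by auto
    ultimately have "?m c = 0"
      by (intro moment_independent[of "{c, d}" n]) auto
    then show False
      by simp
  qed
  have indep: "\<not> ext.dependent (moment n ` C)"
  proof (rule ext.independent_if_scalars_zero)
    fix h and x assume sum: "(\<Sum>x\<in>moment n ` C. ext_scale (h x) x) = 0" and x: "x \<in> moment n ` C"
    then obtain d where "d \<in> C" "x = moment n d"
      by blast
    then show "h x = 0"
      using moment_independent[of C n "h \<circ> moment n" d] sum inj assms by (simp add: sum.reindex)
  qed (use assms in simp)
  let ?M = "(\<lambda>k. ext_monom {k} :: 'k ext) ` {..<n}"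
  have in_span: "g \<in> ext.span ?M" if "g \<in> ext_hom n 1" for g
    by (subst hom1_eq[OF that]) (intro ext.span_sum ext.span_scale ext.span_base, auto)
  show ?thesis
  proof (rule ccontr)
    assume no: "f \<notin> ext.span (moment n ` C)"
    then have "\<not> ext.dependent (insert f (moment n ` C))"
      using indep by (simp add: ext.independent_insert)
    moreover have "insert f (moment n ` C) \<subseteq> ext.span ?M"
      using in_span assms(3) moment_hom by blast
    ultimately have "card (insert f (moment n ` C)) \<le> card ?M"
      using ext.independent_span_bound[of ?M] by simp
    moreover have "card ?M \<le> n"
      using card_image_le[of "{..<n}" "\<lambda>k. ext_monom {k} :: 'k ext"] by simp
    moreover have "f \<notin> moment n ` C"
      using no ext.span_base by blast
    ultimately show False
      using assms by (simp add: card_image[OF inj])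
  qed
qed

text \<open>An argument without determinants: each generator is a combination of the moment vectors
  of \<open>C\<close>. Expanding the product of all generators and dropping terms with repeated
  factors leaves a multiple of \<open>moment_prod n C\<close>, while the top monomial is not
  zero.\<close>

lemma moment_prod_nonzero_full:
  fixes C :: "'k::field set"
  assumes two: "(1::'k) + 1 = 0" and C: "finite C" "card C = n"
  shows "moment_prod n C \<noteq> 0"
proof
  assume zero: "moment_prod n C = 0"
  have "ext_monom {..<r} \<in> ext.span (moment_prod n ` ksub C r)" if "r \<le> n" for r
    using that
  proof (induction r)
    case 0
    have "moment_prod n ({} :: 'k set) \<in> ext.span (moment_prod n ` ksub C 0)"
      by (intro ext.span_base imageI) (simp add: ksub_def)
    moreover have "ext_monom {} = moment_prod n ({} :: 'k set)"
      by (rule ext_eqI) (simp add: moment_prod_def coef_mono one_ext.rep_eq)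
    ultimately show ?case
      by simp
  next
    case (Suc r)
    have "ext_monom {r} * ext_monom {..<r} = (ext_monom {..<Suc r} :: 'k ext)"
      by (simp add: mono_mult lessThan_Suc)
    moreover have "ext_monom {r} * ext_monom {..<r} \<in> ext.span (moment_prod n ` ksub C (Suc r))"
    proof (rule span_mult)
      show "ext_monom {r} \<in> ext.span (moment n ` C)"
        using Suc by (intro moment_span[OF C] mono_hom1) simp
      show "ext_monom {..<r} \<in> ext.span (moment_prod n ` ksub C r)"
        using Suc by simp
    next
      fix s t assume "s \<in> moment n ` C" "t \<in> moment_prod n ` ksub C r"
      then obtain c D where c: "c \<in> C" "s = moment n c" and D: "D \<subseteq> C" "card D = r" "t = moment_prod n D"
        by (auto simp: ksub_def)
      have "finite D"
        using D C finite_subset by blast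
      then show "s * t \<in> ext.span (moment_prod n ` ksub C (Suc r))"
        using c D by (auto simp: moment_mult_prod[OF two] ext.span_zero ksub_def intro!: ext.span_base imageI)
    qed (rule ext.subspace_span)
    ultimately show ?case
      by simp
  qed
  from this[of n] have "ext_monom {..<n} \<in> ext.span (moment_prod n ` ksub C n)"
    by simp
  moreover have "ksub C n = {C}"
    using C card_subset_eq[OF C(1)] by (auto simp: ksub_def)
  ultimately have "ext_monom {..<n} = (0 :: 'k ext)"
    using zero by simp
  then have "coef (ext_monom {..<n} :: 'k ext) {..<n} = 0"
    by simp
  then show False
    by (simp add: coef_mono)
qed

text \<open>The infinite field allows \<open>S\<close> to be completed to \<open>n\<close> points,
  and a factor of a nonzero product is nonzero.\<close>

lemma moment_prod_nonzero:
  fixes S :: "'k::field set"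
  assumes two: "(1::'k) + 1 = 0" and inf: "infinite (UNIV :: 'k set)" and S: "finite S" "card S \<le> n"
  shows "moment_prod n S \<noteq> 0"
proof -
  have "infinite (- S)"
    using inf S(1) by (metis Compl_eq_Diff_UNIV Diff_infinite_finite)
  then obtain T where T: "finite T" "card T = n - card S" "T \<subseteq> - S"
    using infinite_arbitrarily_large by metis
  then have "S \<inter> T = {}"
    by blast
  then have "card (S \<union> T) = n"
    using S T by (simp add: card_Un_disjoint)
  then have "moment_prod n (S \<union> T) \<noteq> 0"
    using S T by (intro moment_prod_nonzero_full[OF two]) auto
  moreover have "moment_prod n (S \<union> T) = moment_prod n S * moment_prod n T"
    using S T by (intro moment_prod_disjoint[symmetric]) auto
  ultimately show ?thesis
    by auto
qed

section \<open>From annihilating vectors back to common points\<close>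

text \<open>A vector annihilating every \<open>moment_prod n (A i)\<close> lies in the span of the vectors of each \<open>A i\<close>;
  in general position, the support of its expansion is contained in all \<open>A i\<close>.\<close>

lemma annihilator_common_point:
  fixes A :: "'i \<Rightarrow> 'k::field set"
  assumes two: "(1::'k) + 1 = 0" and inf: "infinite (UNIV :: 'k set)"
    and v: "v \<in> ext_hom n 1" "v \<noteq> 0" and "finite C" "card C = n"
    and A: "\<And>i. i \<in> I \<Longrightarrow> finite (A i) \<and> v * moment_prod n (A i) = 0"
    and i0: "i0 \<in> I" "A i0 \<subseteq> C"
    and small: "\<And>i. i \<in> I \<Longrightarrow> card (A i0 \<union> A i) \<le> n"
  shows "\<exists>c. \<forall>i\<in>I. c \<in> A i"
proof -
  have "\<exists>\<mu>. v = (\<Sum>c\<in>C. ext_scale (\<mu> c) (moment n c))"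
  proof -
    have "v \<in> ext.span (moment n ` C)"
      using assms by (intro moment_span)
    then obtain \<nu> where "v = (\<Sum>x\<in>moment n ` C. ext_scale (\<nu> x) x)"
      using assms(5) by (auto simp: ext.span_finite)
    moreover have "inj_on (moment n) C"
    proof (rule inj_onI, rule ccontr)
      fix c d assume cd: "c \<in> C" "d \<in> C" "moment n c = moment n d" "c \<noteq> d"
      have "moment_prod n {c, d} = moment n c * moment n c"
        using cd by (simp add: moment_prod_def)
      then have "moment_prod n {c, d} = 0"
        using hom1_square[OF two moment_hom] by simp
      moreover have "card {c, d} \<le> n"
        using cd assms card_mono[of C "{c, d}"] by auto
      ultimately show False
        using moment_prod_nonzero[OF two inf, of "{c, d}" n] by simp
    qed
    ultimately have "v = (\<Sum>c\<in>C. ext_scale (\<nu> (moment n c)) (moment n c))"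
      by (simp add: sum.reindex)
    then show ?thesis
      by (rule exI[of _ "\<lambda>c. \<nu> (moment n c)"])
  qed
  then obtain \<mu> where \<mu>: "v = (\<Sum>c\<in>C. ext_scale (\<mu> c) (moment n c))"
    by blast
  \<comment> \<open>The expansion of \<open>v\<close> over \<open>D\<close> is multiplied by the
    product over \<open>D \<union> A i - {d}\<close>. This contains all factors of
    \<open>A i\<close>, so the result is 0. Every term but the one at \<open>d\<close> has a
    repeated factor, and the product left at \<open>d\<close> is nonzero because at most
    \<open>n\<close> points are involved.\<close>
  have vanish: "\<mu> d = 0"
    if i: "i \<in> I" and D: "finite D" "card (D \<union> A i) \<le> n" "v = (\<Sum>c\<in>D. ext_scale (\<mu> c) (moment n c))"
      and d: "d \<in> D" "d \<notin> A i" for i D d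
  proof -
    let ?R = "D \<union> A i - {d}"
    have R: "finite ?R" "insert d ?R = D \<union> A i"
      using D d A[OF i] by auto
    have "moment_prod n ?R = moment_prod n (A i) * moment_prod n (?R - A i)"
      using d A[OF i] D by (subst moment_prod_disjoint) (auto intro!: arg_cong[of _ _ "moment_prod n"])
    then have "v * moment_prod n ?R = 0"
      using A[OF i] by (simp add: mult.assoc[symmetric])
    then have "0 = (\<Sum>c\<in>D. ext_scale (\<mu> c) (moment n c * moment_prod n ?R))"
      unfolding D(3) by (simp add: sum_distrib_right scl_mult)
    also have "\<dots> = (\<Sum>c\<in>D. if c = d then ext_scale (\<mu> d) (moment_prod n (D \<union> A i)) else 0)"
      using R by (intro sum.cong) (auto simp: moment_mult_prod[OF two])
    also have "\<dots> = ext_scale (\<mu> d) (moment_prod n (D \<union> A i))"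
      using D d by simp
    finally have "ext_scale (\<mu> d) (moment_prod n (D \<union> A i)) = 0" ..
    then show ?thesis
      using moment_prod_nonzero[OF two inf, of "D \<union> A i" n] D A[OF i] by (simp add: ext.scale_eq_0_iff)
  qed
  \<comment> \<open>The set \<open>C \<union> A i\<close> may exceed \<open>n\<close> points, so the
    support is first confined to \<open>A i0\<close>; after that, the bound on
    \<open>A i0 \<union> A i\<close> suffices for every other \<open>i\<close>.\<close>
  have "\<mu> d = 0" if "d \<in> C - A i0" for d
    using vanish[of i0 C d] assms \<mu> that by (simp add: Un_absorb2)
  then have \<mu>0: "v = (\<Sum>c\<in>A i0. ext_scale (\<mu> c) (moment n c))"
    unfolding \<mu> using assms by (intro sum.mono_neutral_right) auto
  then obtain c where c: "c \<in> A i0" "\<mu> c \<noteq> 0"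
    using v(2) by (metis (no_types, lifting) ext.scale_zero_left sum.neutral)
  have "c \<in> A i" if "i \<in> I" for i
    using vanish[OF that _ small[OF that] \<mu>0 c(1)] A[OF i0(1)] c(2) by blast
  then show ?thesis
    by blast
qed

lemma common_point_field:
  fixes A B :: "'i \<Rightarrow> 'k::field set"
  assumes two: "(1::'k) + 1 = 0" and inf: "infinite (UNIV :: 'k set)"
    and I: "finite I" "I \<noteq> {}"
    and A: "\<And>i. i \<in> I \<Longrightarrow> finite (A i) \<and> card (A i) = a"
    and B: "\<And>i. i \<in> I \<Longrightarrow> finite (B i) \<and> card (B i) = b"
    and ab: "a < b" and int: "\<And>i j. i \<in> I \<Longrightarrow> j \<in> I \<Longrightarrow> A i \<inter> A j \<noteq> {}"
    and cross: "cross_pairs I A B" and card: "card I = (a + b - 1) choose (a - 1)"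
  shows "\<exists>c. \<forall>i\<in>I. c \<in> A i"
proof -
  define n where "n = a + b"
  obtain i0 where i0: "i0 \<in> I"
    using I by blast
  have a: "a \<ge> 1"
    using int[OF i0 i0] A[OF i0] by (metis One_nat_def Suc_leI card_gt_0_iff inf.idem)
  let ?p = "\<lambda>i. moment_prod n (A i)" and ?q = "\<lambda>i. moment_prod n (B i)"
  have pq: "?p i * ?q j = 0 \<longleftrightarrow> i \<noteq> j" if "i \<in> I" "j \<in> I" for i j
  proof (cases "i = j")
    case True
    then have disj: "A i \<inter> B j = {}"
      using cross that by (auto simp: cross_pairs_def)
    then have "?p i * ?q j = moment_prod n (A i \<union> B j)"
      using A B that by (intro moment_prod_disjoint) auto
    moreover have "card (A i \<union> B j) = n"
      using A B that disj by (simp add: card_Un_disjoint n_def)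
    ultimately show ?thesis
      using moment_prod_nonzero[OF two inf, of "A i \<union> B j" n] A B that True by simp
  next
    case False
    then have "A i \<inter> B j \<noteq> {}"
      using cross that by (auto simp: cross_pairs_def)
    then show ?thesis
      using moment_prod_meet[OF two, of "A i" "B j" n] A B that False by simp
  qed
  have inj: "inj_on ?p I"
    by (rule inj_onI) (metis pq)
  \<comment> \<open>Multiplying a linear relation by \<open>?q j\<close> kills every term except the
    one at \<open>j\<close>.\<close>
  have indep: "\<not> ext.dependent (?p ` I)"
  proof (rule ext.independent_if_scalars_zero)
    fix h x assume sum: "(\<Sum>x\<in>?p ` I. ext_scale (h x) x) = 0" and "x \<in> ?p ` I"
    then obtain j where j: "j \<in> I" "x = ?p j"
      by blast
    have "(0 :: 'k ext) = (\<Sum>i\<in>I. ext_scale (h (?p i)) (?p i)) * ?q j"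
      using sum by (simp add: sum.reindex[OF inj])
    also have "\<dots> = (\<Sum>i\<in>I. ext_scale (h (?p i)) (?p i * ?q j))"
      by (simp add: sum_distrib_right scl_mult)
    also have "\<dots> = (\<Sum>i\<in>I. if i = j then ext_scale (h x) (?p j * ?q j) else 0)"
      using pq j by (intro sum.cong) auto
    also have "\<dots> = ext_scale (h x) (?p j * ?q j)"
      using I j by simp
    finally show "h x = 0"
      using pq[OF j(1) j(1)] by (simp add: ext.scale_eq_0_iff)
  qed (use I in simp)
  let ?U = "ext.span (?p ` I)"
  have "\<exists>v\<in>ext_hom n 1. v \<noteq> 0 \<and> (\<forall>u\<in>?U. v * u = 0)"
  proof (rule exterior_erdos_ko_rado_tight[OF two])
    show "ext.subspace ?U"
      by (rule ext.subspace_span)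
    have "?p i \<in> ext_hom n a" if "i \<in> I" for i
      using moment_prod_hom[of "A i" n] A[OF that] by simp
    then show "?U \<subseteq> ext_hom n a"
      by (intro ext.span_minimal subspace_hom) auto
    show "u * v = 0" if "u \<in> ?U" "v \<in> ?U" for u v
    proof -
      have "u * v \<in> {0}"
      proof (rule span_mult[OF that])
        fix s t assume "s \<in> ?p ` I" "t \<in> ?p ` I"
        then show "s * t \<in> {0}"
          using moment_prod_meet[OF two] A int by auto
      qed (rule ext.subspace_single_0)
      then show ?thesis
        by simp
    qed
    show "2 * a < n" "1 \<le> a"
      using ab a by (auto simp: n_def)
    show "?p ` I \<subseteq> ?U"
      by (rule ext.span_superset)
    show "card (?p ` I) = (n - 1) choose (a - 1)"
      unfolding card_image[OF inj] using card by (simp add: n_def)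
  qed (rule indep)
  then obtain v where v: "v \<in> ext_hom n 1" "v \<noteq> 0" and v_U: "\<And>u. u \<in> ?U \<Longrightarrow> v * u = 0"
    by blast
  have v_p: "v * ?p i = 0" if "i \<in> I" for i
    by (rule v_U) (intro ext.span_base imageI that)
  have "A i0 \<inter> B i0 = {}"
    using cross i0 by (auto simp: cross_pairs_def)
  then have C: "finite (A i0 \<union> B i0)" "card (A i0 \<union> B i0) = n"
    using A[OF i0] B[OF i0] by (auto simp: card_Un_disjoint n_def)
  show ?thesis
  proof (rule annihilator_common_point[OF two inf v C])
    show "card (A i0 \<union> A i) \<le> n" if "i \<in> I" for i
      using card_Un_le[of "A i0" "A i"] A[OF that] A[OF i0] ab by (simp add: n_def)
  qed (use A v_p i0 in auto)
qed

text \<open>The points of an arbitrary type are relabelled injectively by elements of the rational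
  function field over the two-element field, which has characteristic two and is infinite because
  powers of the variable are distinct. The hypotheses concern only sizes and intersections, so they
  are preserved.\<close>

lemma common_point:
  fixes A B :: "'i \<Rightarrow> 'a set"
  assumes I: "finite I" "I \<noteq> {}"
    and A: "\<And>i. i \<in> I \<Longrightarrow> finite (A i) \<and> card (A i) = a"
    and B: "\<And>i. i \<in> I \<Longrightarrow> finite (B i) \<and> card (B i) = b"
    and ab: "a < b" and int: "\<And>i j. i \<in> I \<Longrightarrow> j \<in> I \<Longrightarrow> A i \<inter> A j \<noteq> {}"
    and cross: "cross_pairs I A B" and card: "card I = (a + b - 1) choose (a - 1)"
  shows "\<exists>c. \<forall>i\<in>I. c \<in> A i"
proof -
  define X where "X = (\<Union>i\<in>I. A i \<union> B i)"
  have "finite X"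
    using I A B by (auto simp: X_def)
  have two: "(1 :: bit poly fract) + 1 = 0"
  proof -
    have "(1 :: bit poly) + 1 = 0"
      by (simp add: one_pCons)
    then show ?thesis
      by (simp add: One_fract_def Zero_fract_def)
  qed
  have inf: "infinite (UNIV :: bit poly fract set)"
  proof -
    have "inj (\<lambda>k. monom (1::bit) k)"
      by (rule injI) (metis degree_monom_eq zero_neq_one)
    moreover have "inj (\<lambda>p :: bit poly. Fract p 1)"
      by (rule injI) (simp add: eq_fract)
    ultimately have "inj ((\<lambda>p :: bit poly. Fract p 1) \<circ> (\<lambda>k. monom 1 k))"
      by (intro inj_compose)
    from infinite_super[OF subset_UNIV range_inj_infinite[OF this]] show ?thesis .
  qed
  obtain Y :: "bit poly fract set" where "finite Y" "card Y = card X"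
    using infinite_arbitrarily_large[OF inf] by blast
  then obtain t where t: "bij_betw t X Y"
    using \<open>finite X\<close> finite_same_card_bij by metis
  then have inj: "inj_on t X"
    by (rule bij_betw_imp_inj_on)
  have sub: "A i \<subseteq> X" "B i \<subseteq> X" if "i \<in> I" for i
    using that by (auto simp: X_def)
  have inter: "t ` S \<inter> t ` T = t ` (S \<inter> T)" if "S \<subseteq> X" "T \<subseteq> X" for S T
    using inj_on_image_Int[OF inj that] by simp
  have "\<exists>c. \<forall>i\<in>I. c \<in> t ` A i"
  proof (rule common_point_field[OF two inf I _ _ ab _ _ card])
    show "finite (t ` A i) \<and> card (t ` A i) = a" "finite (t ` B i) \<and> card (t ` B i) = b" if "i \<in> I" for i
      using A[OF that] B[OF that] sub[OF that] inj_on_subset[OF inj] by (auto simp: card_image)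
    show "t ` A i \<inter> t ` A j \<noteq> {}" if "i \<in> I" "j \<in> I" for i j
      using inter sub that int by simp
    show "cross_pairs I (\<lambda>i. t ` A i) (\<lambda>i. t ` B i)"
      using cross inter sub by (simp add: cross_pairs_def)
  qed
  then obtain c where c: "\<And>i. i \<in> I \<Longrightarrow> c \<in> t ` A i"
    by blast
  obtain i0 where i0: "i0 \<in> I"
    using I by blast
  obtain x where x: "x \<in> A i0" "c = t x"
    using c[OF i0] by blast
  have "x \<in> A i" if i: "i \<in> I" for i
  proof -
    obtain y where "y \<in> A i" "t y = t x"
      using c[OF i] x by auto
    then show ?thesis
      using inj_onD[OF inj, of y x] sub[OF i] sub[OF i0] x by auto
  qed
  then show ?thesis
    by blast
qed

section \<open>Characterization of the extremal pairs\<close>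

theorem theorem1p6:
  fixes m a b :: nat
    and A B :: "nat \<Rightarrow> 'a set"
    and X :: "'a set"
  assumes "m > 0"
    and "\<And>i. i \<in> {1..m} \<Longrightarrow> finite (A i) \<and> card (A i) = a"
    and "\<And>i. i \<in> {1..m} \<Longrightarrow> finite (B i) \<and> card (B i) = b"
    and "a < b"
    and "\<And>i j. i \<in> {1..m} \<Longrightarrow> j \<in> {1..m} \<Longrightarrow> card (A i \<inter> A j) > 0"
    and "\<And>i j. i \<in> {1..m} \<Longrightarrow> j \<in> {1..m} \<Longrightarrow> card (A i \<inter> B j) = 0 \<longleftrightarrow> i = j"
    and "X = (\<Union>i\<in>{1..m}. A i \<union> B i)"
  shows "m = (a + b - 1) choose (a - 1) \<longleftrightarrow>
    card X = a + b \<and>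
    (\<exists>x\<in>X. A ` {1..m} = {S. S \<subseteq> X \<and> card S = a \<and> x \<in> S}) \<and>
    (\<forall>i\<in>{1..m}. B i = X - A i)"
proof -
  let ?I = "{1..m}"
  have I: "finite ?I" "?I \<noteq> {}" "1 \<in> ?I"
    using assms(1) by auto
  have finX: "finite X"
    using assms(2,3) unfolding assms(7) by auto
  have int: "A i \<inter> A j \<noteq> {}" if "i \<in> ?I" "j \<in> ?I" for i j
    using assms(5)[OF that] by auto
  have cross_iff: "A i \<inter> B j = {} \<longleftrightarrow> i = j" if "i \<in> ?I" "j \<in> ?I" for i j
    using assms(6)[OF that] assms(2)[OF that(1)] by (metis card.empty card_0_eq finite_Int)
  then have cross: "cross_pairs ?I A B"
    by (simp add: cross_pairs_def)
  have inj: "inj_on A ?I"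
    by (rule inj_onI) (metis cross_iff)
  have a: "a \<ge> 1"
    using int[OF I(3) I(3)] assms(2)[OF I(3)] by (metis One_nat_def Suc_leI card_gt_0_iff inf.idem)
  show ?thesis
  proof
    assume "card X = a + b \<and> (\<exists>x\<in>X. A ` ?I = {S. S \<subseteq> X \<and> card S = a \<and> x \<in> S}) \<and> (\<forall>i\<in>?I. B i = X - A i)"
    then obtain x where x: "card X = a + b" "x \<in> X" "A ` ?I = {S \<in> ksub X a. x \<in> S}"
      by (auto simp: ksub_def)
    have "m = card (A ` ?I)"
      unfolding card_image[OF inj] by simp
    then show "m = (a + b - 1) choose (a - 1)"
      using x card_star[OF x(2) a finX] by simp
  next
    assume m: "m = (a + b - 1) choose (a - 1)"
    have "card ?I = (a + b - 1) choose (a - 1)"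
      using m by simp
    then obtain x where x: "\<And>i. i \<in> ?I \<Longrightarrow> x \<in> A i"
      using common_point[OF I(1,2) assms(2,3,4) int cross] by blast
    define A' where "A' i = A i - {x}" for i
    have xB: "x \<notin> B i" if "i \<in> ?I" for i
      using x[OF that] cross_iff[OF that that] by auto
    \<comment> \<open>The common point lies in \<open>A j\<close>, hence not in \<open>B j\<close>,
      so removing it changes no intersection with the second sets.\<close>
    have A'B: "A' i \<inter> B j = A i \<inter> B j" if "i \<in> ?I" "j \<in> ?I" for i j
      using xB[OF that(2)] by (auto simp: A'_def)
    have tight: "A' j \<union> B j = A' 1 \<union> B 1" if "j \<in> ?I" for j
    proof (rule bollobas_uniform_tight[OF I(1) _ _ assms(3) _ I(3) that])
      show "cross_pairs ?I A' B"
        using cross_iff A'B by (simp add: cross_pairs_def)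
      show "finite (A' i) \<and> card (A' i) = a - 1" if "i \<in> ?I" for i
        using assms(2)[OF that] x[OF that] by (simp add: A'_def)
      show "card ?I = (a - 1 + b) choose (a - 1)"
        using m a by simp
    qed
    have union: "A i \<union> B i = A 1 \<union> B 1" if "i \<in> ?I" for i
      using tight[OF that] x[OF that] x[OF I(3)] unfolding A'_def by blast
    then have X: "X = A i \<union> B i" if "i \<in> ?I" for i
      using that I(3) unfolding assms(7) by blast
    have B: "\<forall>i\<in>?I. B i = X - A i"
      using X cross_iff by blast
    have cardX: "card X = a + b"
      using X[OF I(3)] cross_iff[OF I(3) I(3)] assms(2,3)[OF I(3)] by (simp add: card_Un_disjoint)
    have xX: "x \<in> X"
      using X[OF I(3)] x[OF I(3)] by blast
    have "A ` ?I = {S \<in> ksub X a. x \<in> S}"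
    proof (rule star_unique[OF finX xX a])
      show "A ` ?I \<subseteq> ksub X a"
        using assms(2) X by (auto simp: ksub_def)
      show "card (A ` ?I) = (card X - 1) choose (a - 1)"
        unfolding card_image[OF inj] using m cardX by simp
    qed (use x in auto)
    then show "card X = a + b \<and> (\<exists>x\<in>X. A ` ?I = {S. S \<subseteq> X \<and> card S = a \<and> x \<in> S}) \<and> (\<forall>i\<in>?I. B i = X - A i)"
      using cardX xX B by (auto simp: ksub_def)
  qed
qed

end
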